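(* Let $\alpha,\beta>0$ be real, $\Lambda=\mathbb{Z}\alpha+\mathbb{Z}\beta i$, $\wp(z)=\wp(z;\Lambda)$, and set $e_1=\wp(\alpha/2)$, $e_2=\wp(\beta i/2)$, $e_3=\wp((\alpha+\beta i)/2)$, which are real with $e_1>e_3>e_2$. Let $G$ be the wallpaper group p2gg realised as the group generated by the translations by elements of $\Lambda$, the rotation $z\mapsto -z$, and the glide reflexion $L.z=\overline{z+\tfrac12(\alpha+\beta i)}$. Then the meromorphic functions $f:\mathbb{C}\to\mathbb{CP}^1$ invariant under the modified action of $G$ are exactly the functions $$f(z)=Q\left(\frac{\wp(z)-a}{c}\right),\qquad a=e_3,\quad c=\sqrt{(e_1-e_3)(e_3-e_2)},$$ where $Q$ is a rational function of the form $$Q(w)=C\,w^p\,\frac{\prod_k\left((w-a_k)(\bar a_k w+1)\right)^{\lambda_k}}{\prod_l\left((w-b_l)(\bar b_l w+1)\right)^{\mu_l}}$$ with finite products, $a_k,b_l\in\mathbb{C}\setminus\{0\}$, $C\in\mathbb{R}$, $p\in\mathbb{Z}$, positive integers $\lambda_k,\mu_l$, and $\sum_l\mu_l=p+\sum_k\lambda_k$.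
   Context: Modified action: a sense-preserving $g\in G$, $g.z=az+b$, sends $f$ to $z\mapsto f(g.z)$; a sense-reversing $m\in G$, $m.z=a\bar z+b$, sends $f$ to $z\mapsto\overline{f(m.z)}$ (with $\overline{\infty}=\infty$). $f$ is invariant if it is unchanged by the modified action of every element of $G$. The Weierstrass function of a lattice $\Lambda$ is $\wp(z;\Lambda)=\frac1{z^2}+\sum_{\lambda\in\Lambda\setminus\{0\}}\left(\frac1{(z-\lambda)^2}-\frac1{\lambda^2}\right)$. Empty products are $1$ and empty sums are $0$. *)

theory Defs
  imports
    "HOL-Complex_Analysis.Complex_Analysis"
    "HOL-Computational_Algebra.Computational_Algebra"
    "HOL-Computational_Algebra.Field_as_Ring"
    "HOL-Algebra.Bij"
    "HOL-Algebra.Generated_Groups"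
begin

text \<open>
  The Riemann sphere is represented as in the library's one-point compactification
  \<open>Alexandroff_compactification\<close>: \<^term>\<open>None\<close> is the point at infinity. Thus
  \<^term>\<open>map_option h\<close> applies \<open>h\<close> to the finite points and fixes infinity.
\<close>

type_synonym riemann_sphere = "complex option"

text \<open>
  A function that is \<open>nicely_meromorphic_on\<close> has no removable singularities, but takes the
  junk value 0 at its poles; here it gets the value infinity there. The constant infinity
  is not a meromorphic function.
\<close>

definition meromorphic_to_sphere :: "(complex \<Rightarrow> riemann_sphere) \<Rightarrow> bool" where
  "meromorphic_to_sphere f \<longleftrightarrow>
     (\<exists>g. g nicely_meromorphic_on UNIV \<and>
          f = (\<lambda>z. if is_pole g z then None else Some (g z)))"

definition rect_lattice :: "real \<Rightarrow> real \<Rightarrow> complex set" where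
  "rect_lattice \<alpha> \<beta> =
     {of_int m * complex_of_real \<alpha> + of_int n * (complex_of_real \<beta> * \<i>) | m n. True}"

text \<open>The finite values of the Weierstrass function, meaningful only off the lattice.\<close>

definition weierstrass_p :: "complex set \<Rightarrow> complex \<Rightarrow> complex" where
  "weierstrass_p \<Lambda> z =
     1 / z\<^sup>2 + (\<Sum>\<^sub>\<infinity>u\<in>\<Lambda> - {0}. (1 / (z - u)\<^sup>2 - 1 / u\<^sup>2))"

definition weierstrass_sphere :: "complex set \<Rightarrow> complex \<Rightarrow> riemann_sphere" where
  "weierstrass_sphere \<Lambda> z = (if z \<in> \<Lambda> then None else Some (weierstrass_p \<Lambda> z))"

definition sense_preserving :: "(complex \<Rightarrow> complex) \<Rightarrow> bool" where
  "sense_preserving g \<longleftrightarrow> (\<exists>a b. a \<noteq> 0 \<and> g = (\<lambda>z. a * z + b))"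

text \<open>
  The second branch is meant for the sense-reversing maps \<open>z \<mapsto> a * cnj z + b\<close>; the groups
  to which this is applied consist of maps of these two kinds only.
\<close>

definition modified_action ::
    "(complex \<Rightarrow> complex) \<Rightarrow> (complex \<Rightarrow> riemann_sphere) \<Rightarrow> complex \<Rightarrow> riemann_sphere" where
  "modified_action g f =
     (if sense_preserving g then (\<lambda>z. f (g z)) else (\<lambda>z. map_option cnj (f (g z))))"

definition invariant_under :: "(complex \<Rightarrow> complex) set \<Rightarrow> (complex \<Rightarrow> riemann_sphere) \<Rightarrow> bool" where
  "invariant_under G f \<longleftrightarrow> (\<forall>g\<in>G. modified_action g f = f)"

definition p2gg_group :: "real \<Rightarrow> real \<Rightarrow> (complex \<Rightarrow> complex) set" where
  "p2gg_group \<alpha> \<beta> =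
     generate (BijGroup UNIV)
       ({(\<lambda>z. z + u) | u. u \<in> rect_lattice \<alpha> \<beta>} \<union> {\<lambda>z. - z} \<union>
        {\<lambda>z. cnj (z + (complex_of_real \<alpha> + complex_of_real \<beta> * \<i>) / 2)})"

text \<open>
  The self-map of the Riemann sphere induced by a rational function. The pair
  \<^term>\<open>quot_of_fract Q\<close> is coprime, so \<open>Q\<close> has a pole at every zero of the denominator;
  at infinity, \<^term>\<open>coeff n (degree d)\<close> is 0 when \<open>n\<close> has the smaller degree.
\<close>

definition rational_map :: "complex poly fract \<Rightarrow> riemann_sphere \<Rightarrow> riemann_sphere" where
  "rational_map Q x =
     (case quot_of_fract Q of (n, d) \<Rightarrow>
       (case x of
          Some w \<Rightarrow> if poly d w = 0 then None else Some (poly n w / poly d w)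
        | None \<Rightarrow> if degree n > degree d then None
                  else Some (coeff n (degree d) / lead_coeff d)))"

definition antipodal_factor :: "complex \<Rightarrow> complex poly fract" where
  "antipodal_factor a = to_fract ([:- a, 1:] * [:1, cnj a:])"

definition p2gg_rational :: "complex poly fract set" where
  "p2gg_rational =
     {to_fract [:complex_of_real C:] * to_fract [:0, 1:] powi p *
        ((\<Prod>k<r. antipodal_factor (a k) ^ \<kappa> k) / (\<Prod>l<s. antipodal_factor (b l) ^ \<mu> l))
      | (C :: real) (p :: int) (r :: nat) (s :: nat)
        (a :: nat \<Rightarrow> complex) (b :: nat \<Rightarrow> complex) (\<kappa> :: nat \<Rightarrow> nat) (\<mu> :: nat \<Rightarrow> nat).
        (\<forall>k<r. a k \<noteq> 0 \<and> \<kappa> k > 0) \<and> (\<forall>l<s. b l \<noteq> 0 \<and> \<mu> l > 0) \<and>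
        (\<Sum>l<s. int (\<mu> l)) = p + (\<Sum>k<r. int (\<kappa> k))}"

end

theory Submission
  imports Defs
begin

text \<open>
  Let \<open>W = (\<wp> - e\<^sub>3) / c\<close> and let \<open>\<omega> = (\<alpha> + \<beta> \<i>) / 2\<close>. The function
  \<open>(\<wp> z - e\<^sub>3) (\<wp> (z + \<omega>) - e\<^sub>3)\<close> is elliptic without poles, because the double zero of one
  factor meets the double pole of the other; so it is constant, and the constant is
  \<open>(e\<^sub>1 - e\<^sub>3) (e\<^sub>2 - e\<^sub>3) = - c\<^sup>2\<close>. Hence \<open>W (z + \<omega>) = - 1 / W z\<close>, and the glide reflexion acts on
  the values of \<open>W\<close> as the antipodal map \<open>w \<mapsto> - 1 / cnj w\<close>. Invariance under the translations
  and the rotation means that the function is \<open>Q \<circ> W\<close> with \<open>Q\<close> rational, and invariance under the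
  glide reflexion that \<open>Q (- 1 / cnj w) = cnj (Q w)\<close>. The zeros and poles of such a \<open>Q\<close> come in
  antipodal pairs, and splitting off one pair at a time gives the product form.
\<close>

section \<open>The Weierstrass function of a rectangular lattice\<close>

text \<open>The constant of the translate product must be known to be nonzero before its value is of
  use, since \<open>c\<close> could otherwise vanish. Its nonvanishing comes from the pole of \<wp>
  at 0 alone. Then \<wp> can take the value e3 only at translates of \<omega>, so along each axis it
  stays on one side of e3, and this gives e1 > e3 > e2. Only now is division by \<open>c\<close>
  legitimate; \<open>c\<close> is the normalisation that turns the involution into w \<mapsto> - 1 /
  w. A meromorphic function may have arbitrary values at isolated points, so identities are proved
  on punctured neighbourhoods and reach the sphere by uniqueness of limits. They pass from z to w =
  W z because a nonzero polynomial in W has only isolated zeros. On the rational side, the antipodal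
  map has no fixed point, so a nonzero root and its antipode are always two different roots. Every
  factor of the product form picks up the same multiplier - w^2 under the antipodal map followed by
  conjugation, which explains the single linear condition on the exponents.\<close>

lemma summable_on_int_powr:
  "(\<lambda>n::int. (1 + real_of_int \<bar>n\<bar>) powr (- 3 / 2)) summable_on UNIV"
proof -
  have nat: "(\<lambda>n::nat. (1 + real n) powr (- 3 / 2)) summable_on UNIV"
  proof (rule norm_summable_imp_summable_on)
    have "summable (\<lambda>n. real (Suc n) powr (- 3 / 2))"
      by (subst summable_Suc_iff) (simp add: summable_real_powr_iff)
    then show "summable (\<lambda>n. norm ((1 + real n) powr (- 3 / 2)))"
      by (simp add: add.commute)
  qed
  have "(\<lambda>n::int. (1 + real_of_int \<bar>n\<bar>) powr (- 3 / 2)) summable_on range int"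
    using nat by (subst summable_on_reindex) (auto simp: o_def)
  moreover have "(\<lambda>n::int. (1 + real_of_int \<bar>n\<bar>) powr (- 3 / 2)) summable_on range (\<lambda>n. - int n)"
    using nat by (subst summable_on_reindex) (auto simp: o_def inj_on_def)
  ultimately have "(\<lambda>n::int. (1 + real_of_int \<bar>n\<bar>) powr (- 3 / 2)) summable_on
      (range int \<union> range (\<lambda>n. - int n))"
    by (rule summable_on_union)
  moreover have "range int \<union> range (\<lambda>n. - int n) = UNIV"
    by (auto simp: image_iff) (metis int_cases2)
  ultimately show ?thesis by simp
qed

lemma summable_on_prod_nonneg:
  fixes f :: "'a \<Rightarrow> real"
  assumes "f summable_on UNIV" "\<And>x. f x \<ge> 0"
  shows "(\<lambda>(x, y). f x * f y) summable_on UNIV"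
proof -
  have "(\<lambda>(x, y). f x * f y) summable_on (Sigma UNIV (\<lambda>_. UNIV))"
  proof (rule summable_on_SigmaI)
    show "((\<lambda>y. case (x, y) of (x, y) \<Rightarrow> f x * f y) has_sum (f x * infsum f UNIV)) UNIV" for x
      using assms by (auto intro!: has_sum_cmult_right)
    show "(\<lambda>x. f x * infsum f UNIV) summable_on UNIV"
      using assms by (intro summable_on_cmult_left) auto
  qed (use assms in auto)
  then show ?thesis by simp
qed

locale rectangular_lattice =
  fixes \<alpha> \<beta> :: real and \<Lambda> :: "complex set"
  assumes pos: "\<alpha> > 0" "\<beta> > 0"
    and lattice: "\<Lambda> = rect_lattice \<alpha> \<beta>"
begin

abbreviation wp ("\<wp>") where "\<wp> \<equiv> weierstrass_p \<Lambda>"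

lemma lattice_iff: "u \<in> \<Lambda> \<longleftrightarrow> (\<exists>m n. u = Complex (of_int m * \<alpha>) (of_int n * \<beta>))"
  unfolding lattice rect_lattice_def by (simp add: complex_eq_iff)

lemma lattice_0 [simp]: "0 \<in> \<Lambda>"
  unfolding lattice_iff by (intro exI[of _ 0]) (auto simp: complex_eq_iff)

lemma lattice_add: "u \<in> \<Lambda> \<Longrightarrow> v \<in> \<Lambda> \<Longrightarrow> u + v \<in> \<Lambda>"
  unfolding lattice_iff
proof clarify
  fix m n m' n'
  show "\<exists>k l. Complex (of_int m * \<alpha>) (of_int n * \<beta>) + Complex (of_int m' * \<alpha>) (of_int n' * \<beta>) =
    Complex (of_int k * \<alpha>) (of_int l * \<beta>)"
    by (intro exI[of _ "m + m'"] exI[of _ "n + n'"]) (simp add: complex_eq_iff algebra_simps)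
qed

lemma lattice_minus: "u \<in> \<Lambda> \<Longrightarrow> - u \<in> \<Lambda>"
  unfolding lattice_iff
proof clarify
  fix m n
  show "\<exists>k l. - Complex (of_int m * \<alpha>) (of_int n * \<beta>) = Complex (of_int k * \<alpha>) (of_int l * \<beta>)"
    by (intro exI[of _ "- m"] exI[of _ "- n"]) (simp add: complex_eq_iff)
qed

lemma lattice_minus_iff [simp]: "- u \<in> \<Lambda> \<longleftrightarrow> u \<in> \<Lambda>"
  using lattice_minus[of u] lattice_minus[of "- u"] by auto

lemma lattice_diff: "u \<in> \<Lambda> \<Longrightarrow> v \<in> \<Lambda> \<Longrightarrow> u - v \<in> \<Lambda>"
  using lattice_add[of u "- v"] by simp

lemma lattice_add_iff: "v \<in> \<Lambda> \<Longrightarrow> u + v \<in> \<Lambda> \<longleftrightarrow> u \<in> \<Lambda>"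
  using lattice_add[of u v] lattice_diff[of "u + v" v] by auto

lemma lattice_cnj: "u \<in> \<Lambda> \<Longrightarrow> cnj u \<in> \<Lambda>"
  unfolding lattice_iff
proof clarify
  fix m n
  show "\<exists>k l. cnj (Complex (of_int m * \<alpha>) (of_int n * \<beta>)) = Complex (of_int k * \<alpha>) (of_int l * \<beta>)"
    by (intro exI[of _ "m"] exI[of _ "- n"]) (simp add: complex_eq_iff)
qed

lemma lattice_cnj_iff [simp]: "cnj u \<in> \<Lambda> \<longleftrightarrow> u \<in> \<Lambda>"
  using lattice_cnj[of u] lattice_cnj[of "cnj u"] by auto

lemma lattice_generators: "complex_of_real \<alpha> \<in> \<Lambda>" "complex_of_real \<beta> * \<i> \<in> \<Lambda>"
  unfolding lattice_iff
  by (rule exI[of _ 1], rule exI[of _ 0], simp add: complex_eq_iff,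
      rule exI[of _ 0], rule exI[of _ 1], simp add: complex_eq_iff)

lemma lattice_periodic:
  assumes "\<And>z. f (z + complex_of_real \<alpha>) = f z" "\<And>z. f (z + complex_of_real \<beta> * \<i>) = f z" "u \<in> \<Lambda>"
  shows "f (z + u) = f z"
proof -
  have int: "f (z + of_int m * v) = f z" if v: "\<And>z. f (z + v) = f z" for z m and v :: complex
  proof (induction m rule: int_induct[of _ 0])
    case (step1 i)
    then show ?case using v[of "z + of_int i * v"] by (simp add: algebra_simps)
  next
    case (step2 i)
    then show ?case using v[of "z + of_int (i - 1) * v"] by (simp add: algebra_simps)
  qed simp
  obtain m n where u: "u = of_int m * complex_of_real \<alpha> + of_int n * (complex_of_real \<beta> * \<i>)"
    using \<open>u \<in> \<Lambda>\<close> unfolding lattice rect_lattice_def by auto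
  show ?thesis
    unfolding u add.assoc[symmetric] using int[OF assms(2)] int[OF assms(1)] by simp
qed

text \<open>A closed disc stands in for a fundamental rectangle. Being compact, it serves both
  Liouville's theorem and the finiteness of the set of poles.\<close>

lemma lattice_reduce: obtains u where "u \<in> \<Lambda>" "norm (z - u) \<le> \<alpha> + \<beta>"
proof
  let ?u = "Complex (of_int \<lfloor>Re z / \<alpha>\<rfloor> * \<alpha>) (of_int \<lfloor>Im z / \<beta>\<rfloor> * \<beta>)"
  show "?u \<in> \<Lambda>" unfolding lattice_iff by blast
  have "\<bar>x - of_int \<lfloor>x / a\<rfloor> * a\<bar> \<le> a" if "a > 0" for x a :: real
  proof -
    define k where "k = real_of_int \<lfloor>x / a\<rfloor>"
    have "k * a \<le> x" "x < (k + 1) * a"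
      unfolding k_def by (rule floor_divide_lower[OF that] floor_divide_upper[OF that])+
    then have "\<bar>x - k * a\<bar> \<le> a" by (simp add: algebra_simps abs_le_iff)
    then show ?thesis unfolding k_def .
  qed
  from this[OF pos(1), of "Re z"] this[OF pos(2), of "Im z"]
  show "norm (z - ?u) \<le> \<alpha> + \<beta>"
    using cmod_le[of "z - ?u"] by simp
qed

lemma finite_lattice_cball: "finite (\<Lambda> \<inter> cball 0 r)"
proof (rule finite_subset)
  let ?M = "{\<lfloor>- r / \<alpha>\<rfloor>..\<lceil>r / \<alpha>\<rceil>}" and ?N = "{\<lfloor>- r / \<beta>\<rfloor>..\<lceil>r / \<beta>\<rceil>}"
  have *: "m \<in> {\<lfloor>- r / a\<rfloor>..\<lceil>r / a\<rceil>}" if "a > 0" "\<bar>of_int m * a\<bar> \<le> r" for m :: int and a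
  proof -
    have "- r / a \<le> of_int m" "of_int m \<le> r / a"
      using that by (simp_all add: field_simps abs_le_iff)
    then show ?thesis by (auto simp: le_ceiling_iff floor_le_iff) 
  qed
  show "\<Lambda> \<inter> cball 0 r \<subseteq> (\<lambda>(m, n). Complex (of_int m * \<alpha>) (of_int n * \<beta>)) ` (?M \<times> ?N)"
  proof
    fix u assume "u \<in> \<Lambda> \<inter> cball 0 r"
    then obtain m n where u: "u = Complex (of_int m * \<alpha>) (of_int n * \<beta>)" "norm u \<le> r"
      by (auto simp: lattice_iff)
    then have "\<bar>of_int m * \<alpha>\<bar> \<le> r" "\<bar>of_int n * \<beta>\<bar> \<le> r"
      using abs_Re_le_cmod[of u] abs_Im_le_cmod[of u] by simp_all
    then have "m \<in> ?M" "n \<in> ?N" using * pos by blast+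
    then show "u \<in> (\<lambda>(m, n). Complex (of_int m * \<alpha>) (of_int n * \<beta>)) ` (?M \<times> ?N)"
      using u by auto
  qed
qed auto

text \<open>The cube is shared evenly between the coordinates: \<open>norm u\<close> dominates a
  multiple of \<open>1 + \<bar>m\<bar>\<close> and of \<open>1 + \<bar>n\<bar>\<close>, so the
  double series is bounded by a product of two single series with exponent 3/2 > 1.\<close>

lemma summable_lattice_inverse_cube: "(\<lambda>u. 1 / norm u ^ 3) summable_on \<Lambda> - {0}"
proof -
  define h where "h = (\<lambda>(m, n). Complex (of_int m * \<alpha>) (of_int n * \<beta>))"
  have inj: "inj h" using pos by (auto simp: inj_on_def h_def)
  have h0: "h p = 0 \<longleftrightarrow> p = (0, 0)" for p
    using pos by (cases p) (auto simp: h_def complex_eq_iff)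
  have \<Lambda>: "\<Lambda> - {0} = h ` (UNIV - {(0, 0)})"
  proof -
    have "\<Lambda> = range h" by (auto simp: lattice_iff h_def image_iff)
    moreover have "range h - {0} = h ` (UNIV - {(0, 0)})" using h0 by (auto simp del: split_paired_All)
    ultimately show ?thesis by simp
  qed
  define \<phi> where "\<phi> = (\<lambda>n::int. (1 + real_of_int \<bar>n\<bar>) powr (- 3 / 2))"
  \<comment> \<open>Half of the smaller side: \<open>norm (h p)\<close> is at least
    \<open>2 * \<delta> * \<bar>m\<bar>\<close> and, for nonzero \<open>p\<close>, at least
    \<open>2 * \<delta>\<close>; the mean of the two bounds is
    \<open>\<delta> * (1 + \<bar>m\<bar>)\<close>.\<close>
  define \<delta> where "\<delta> = min \<alpha> \<beta> / 2"
  have \<delta>: "\<delta> > 0" using pos by (simp add: \<delta>_def)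
  have "(\<lambda>(m, n). \<phi> m * \<phi> n) summable_on UNIV"
    using summable_on_int_powr by (intro summable_on_prod_nonneg) (auto simp: \<phi>_def)
  then have "(\<lambda>p. (1 / \<delta> ^ 3) * (case p of (m, n) \<Rightarrow> \<phi> m * \<phi> n)) summable_on UNIV"
    by (rule summable_on_cmult_right)
  then have "(\<lambda>p. (1 / \<delta> ^ 3) * (case p of (m, n) \<Rightarrow> \<phi> m * \<phi> n)) summable_on UNIV - {(0, 0)}"
    by (rule summable_on_subset) auto
  then have "(\<lambda>p. 1 / norm (h p) ^ 3) summable_on UNIV - {(0, 0)}"
  proof (rule summable_on_comparison_test)
    fix p :: "int \<times> int" assume p: "p \<in> UNIV - {(0, 0)}"
    obtain m n where mn: "p = (m, n)" by (cases p)
    define x y where "x = 1 + real_of_int \<bar>m\<bar>" and "y = 1 + real_of_int \<bar>n\<bar>"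
    have xy: "x \<ge> 1" "y \<ge> 1" by (auto simp: x_def y_def)
    have hp: "of_int \<bar>m\<bar> * \<alpha> \<le> norm (h p)" "of_int \<bar>n\<bar> * \<beta> \<le> norm (h p)"
      using abs_Re_le_cmod[of "h p"] abs_Im_le_cmod[of "h p"] pos
      by (auto simp: h_def mn abs_mult)
    have d: "\<delta> * 2 * of_int \<bar>m\<bar> \<le> norm (h p)" "\<delta> * 2 * of_int \<bar>n\<bar> \<le> norm (h p)"
    proof -
      have "\<delta> * 2 * of_int \<bar>m\<bar> \<le> \<alpha> * of_int \<bar>m\<bar>" "\<delta> * 2 * of_int \<bar>n\<bar> \<le> \<beta> * of_int \<bar>n\<bar>"
        by (intro mult_right_mono; simp add: \<delta>_def)+
      then show "\<delta> * 2 * of_int \<bar>m\<bar> \<le> norm (h p)" "\<delta> * 2 * of_int \<bar>n\<bar> \<le> norm (h p)"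
        using hp by (simp_all only: mult.commute[of \<alpha>] mult.commute[of \<beta>])
    qed
    have "\<bar>m\<bar> \<ge> 1 \<or> \<bar>n\<bar> \<ge> 1" using p mn by auto
    then have "of_int \<bar>m\<bar> \<ge> (1::real) \<or> of_int \<bar>n\<bar> \<ge> (1::real)" by linarith
    then have one: "\<delta> * 2 \<le> norm (h p)"
    proof
      assume "of_int \<bar>m\<bar> \<ge> (1::real)"
      then have "\<delta> * 2 * 1 \<le> \<delta> * 2 * of_int \<bar>m\<bar>" using \<delta> by (intro mult_left_mono) auto
      with d show ?thesis by linarith
    next
      assume "of_int \<bar>n\<bar> \<ge> (1::real)"
      then have "\<delta> * 2 * 1 \<le> \<delta> * 2 * of_int \<bar>n\<bar>" using \<delta> by (intro mult_left_mono) auto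
      with d show ?thesis by linarith
    qed
    have le: "\<delta> * x \<le> norm (h p)" "\<delta> * y \<le> norm (h p)"
      using d one by (auto simp: x_def y_def algebra_simps)
    have xp: "x powr (3 / 2) > 0" "y powr (3 / 2) > 0" using xy by auto
    have cube: "t powr (3 / 2) * t powr (3 / 2) = t ^ 3" if "t > 0" for t :: real
    proof -
      have "t powr (3 / 2) * t powr (3 / 2) = t powr (real 3)"
        unfolding powr_add[symmetric] by simp
      then show ?thesis using that by (simp only: powr_realpow)
    qed
    have "\<delta> ^ 3 * (x powr (3 / 2) * y powr (3 / 2)) = (\<delta> * x) powr (3 / 2) * (\<delta> * y) powr (3 / 2)"
      using \<delta> xy by (simp add: powr_mult cube[symmetric])
    also have "\<dots> \<le> norm (h p) powr (3 / 2) * norm (h p) powr (3 / 2)"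
      using le \<delta> xy by (intro mult_mono powr_mono2) auto
    also have "\<dots> = norm (h p) ^ 3"
      using one \<delta> by (intro cube) linarith
    finally have main: "\<delta> ^ 3 * (x powr (3 / 2) * y powr (3 / 2)) \<le> norm (h p) ^ 3" .
    have hp0: "norm (h p) ^ 3 > 0" using one \<delta> by (intro zero_less_power) linarith
    have "\<phi> m = 1 / x powr (3 / 2)" "\<phi> n = 1 / y powr (3 / 2)"
      unfolding \<phi>_def x_def y_def by (simp_all add: powr_minus_divide[symmetric])
    then have \<phi>\<phi>: "1 / \<delta> ^ 3 * (\<phi> m * \<phi> n) = 1 / (\<delta> ^ 3 * (x powr (3 / 2) * y powr (3 / 2)))"
      by simp
    have "1 / norm (h p) ^ 3 \<le> 1 / (\<delta> ^ 3 * (x powr (3 / 2) * y powr (3 / 2)))"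
      using main \<delta> xp hp0 by (intro divide_left_mono mult_pos_pos) auto
    then show "1 / norm (h p) ^ 3 \<le> 1 / \<delta> ^ 3 * (case p of (m, n) \<Rightarrow> \<phi> m * \<phi> n)"
      using \<phi>\<phi> by (simp add: mn)
  qed auto
  then show ?thesis
    unfolding \<Lambda> using inj by (subst summable_on_reindex) (auto simp: o_def intro: inj_on_subset)
qed

end

section \<open>Convergence and analyticity of the Weierstrass series\<close>

lemma weierstrass_term_bound:
  fixes z u :: complex
  assumes z: "norm z \<le> R" and u: "norm u \<ge> 2 * R" and "R > 0"
  shows "norm (1 / (z - u)\<^sup>2 - 1 / u\<^sup>2) \<le> 10 * R * (1 / norm u ^ 3)"
proof -
  have u0: "norm u > 0" using assms by linarith
  have zu: "norm (z - u) \<ge> norm u / 2"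
    using norm_triangle_ineq2[of u z] assms by (simp add: norm_minus_commute)
  then have zu0: "norm (z - u) > 0" using u0 by linarith
  \<comment> \<open>Over the common denominator the leading terms cancel and a factor
    \<open>z\<close> comes out, which improves the decay from order 2 to order 3. The constant is 10
    = (5/2) * 4: the numerator is at most \<open>R * (5 / 2 * norm u)\<close> and the denominator at
    least \<open>norm u ^ 4 / 4\<close>.\<close>
  have "1 / (z - u)\<^sup>2 - 1 / u\<^sup>2 = z * (2 * u - z) / ((z - u)\<^sup>2 * u\<^sup>2)"
    using u0 zu0 by (simp add: divide_simps) (simp add: power2_eq_square algebra_simps)
  then have "norm (1 / (z - u)\<^sup>2 - 1 / u\<^sup>2) = norm z * norm (2 * u - z) / (norm (z - u) ^ 2 * norm u ^ 2)"
    by (simp add: norm_divide norm_mult norm_power)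
  also have "\<dots> \<le> R * (5 / 2 * norm u) / ((norm u / 2) ^ 2 * norm u ^ 2)"
  proof (intro frac_le mult_mono mult_right_mono power_mono)
    show "norm (2 * u - z) \<le> 5 / 2 * norm u"
      using norm_triangle_ineq4[of "2 * u" z] assms by (simp add: norm_mult)
  qed (use assms zu u0 in auto)
  also have "\<dots> = 10 * R * (1 / norm u ^ 3)"
    using u0 by (simp add: field_simps power2_eq_square power3_eq_cube)
  finally show ?thesis .
qed

context rectangular_lattice
begin

lemma summable_weierstrass_terms:
  "(\<lambda>u. 1 / (z - u)\<^sup>2 - 1 / u\<^sup>2) summable_on \<Lambda> - {0}"
proof -
  define R where "R = norm z + 1"
  let ?f = "\<lambda>u. 1 / (z - u)\<^sup>2 - 1 / u\<^sup>2"
  have "(\<lambda>u. 10 * R * (1 / norm u ^ 3)) summable_on \<Lambda> - cball 0 (2 * R)"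
    by (intro summable_on_cmult_right summable_on_subset[OF summable_lattice_inverse_cube])
       (auto simp: R_def intro: add_nonneg_nonneg)
  then have "(\<lambda>u. norm (?f u)) summable_on \<Lambda> - cball 0 (2 * R)"
    by (rule summable_on_comparison_test) (use weierstrass_term_bound[of z R] in \<open>auto simp: R_def add_pos_nonneg add_nonneg_pos\<close>)
  then have "?f summable_on \<Lambda> - cball 0 (2 * R)" by (rule abs_summable_summable)
  moreover have "?f summable_on \<Lambda> \<inter> cball 0 (2 * R) - {0}"
    using finite_lattice_cball by (intro summable_on_finite) auto
  ultimately have "?f summable_on (\<Lambda> - cball 0 (2 * R)) \<union> (\<Lambda> \<inter> cball 0 (2 * R) - {0})"
    by (rule summable_on_union)
  moreover have "(\<Lambda> - cball 0 (2 * R)) \<union> (\<Lambda> \<inter> cball 0 (2 * R) - {0}) = \<Lambda> - {0}"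
    by (auto simp: R_def add_nonneg_nonneg)
  ultimately show ?thesis by simp
qed

text \<open>The equation also holds at the lattice points, as \<open>1 / 0 = 0\<close>.\<close>

lemma wp_local:
  assumes R: "R > 0"
  obtains F T where "finite F" "F \<subseteq> \<Lambda>" "\<Lambda> \<inter> ball 0 R \<subseteq> F" "T holomorphic_on ball 0 R"
    "\<And>z. z \<in> ball 0 R \<Longrightarrow> \<wp> z = (\<Sum>u\<in>F. 1 / (z - u)\<^sup>2) + T z"
proof
  let ?f = "\<lambda>u z. 1 / (z - u)\<^sup>2 - 1 / u\<^sup>2"
  \<comment> \<open>The radius is \<open>2 * R\<close> so that every \<open>u\<close> outside
    \<open>F\<close> meets the hypothesis of \<open>weierstrass_term_bound\<close> on the disc of
    radius \<open>R\<close>. The terms of \<open>F\<close> appear without their subtracted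
    constants, which \<open>T\<close> takes over.\<close>
  define F where "F = \<Lambda> \<inter> cball 0 (2 * R)"
  define T where "T = (\<lambda>z. (\<Sum>\<^sub>\<infinity>u\<in>\<Lambda> - F. ?f u z) - (\<Sum>u\<in>F - {0}. 1 / u\<^sup>2))"
  show fin: "finite F" unfolding F_def by (rule finite_lattice_cball)
  show "F \<subseteq> \<Lambda>" "\<Lambda> \<inter> ball 0 R \<subseteq> F" using R by (auto simp: F_def)
  have "(\<lambda>z. \<Sum>\<^sub>\<infinity>u\<in>\<Lambda> - F. ?f u z) holomorphic_on ball 0 R"
  proof (rule holomorphic_uniform_limit)
    show "uniform_limit (cball 0 R) (\<lambda>X z. \<Sum>u\<in>X. ?f u z) (\<lambda>z. \<Sum>\<^sub>\<infinity>u\<in>\<Lambda> - F. ?f u z)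
        (finite_subsets_at_top (\<Lambda> - F))"
    proof (rule Weierstrass_m_test_general)
      show "norm (?f u z) \<le> 10 * R * (1 / norm u ^ 3)" if "u \<in> \<Lambda> - F" "z \<in> cball 0 R" for u z
        using that R by (intro weierstrass_term_bound) (auto simp: F_def)
      show "(\<lambda>u. 10 * R * (1 / norm u ^ 3)) summable_on \<Lambda> - F"
        using R by (intro summable_on_cmult_right summable_on_subset[OF summable_lattice_inverse_cube])
           (auto simp: F_def)
    qed
    have ne: "z \<noteq> u" if "u \<in> \<Lambda> - F" "z \<in> cball 0 R" for u z
      using that R by (auto simp: F_def)
    have "(\<lambda>z. \<Sum>u\<in>X. ?f u z) holomorphic_on cball 0 R" if "X \<subseteq> \<Lambda> - F" for X
      using that ne by (intro holomorphic_intros) (auto simp: subset_iff)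
    then show "\<forall>\<^sub>F X in finite_subsets_at_top (\<Lambda> - F).
        continuous_on (cball 0 R) (\<lambda>z. \<Sum>u\<in>X. ?f u z) \<and> (\<lambda>z. \<Sum>u\<in>X. ?f u z) holomorphic_on ball 0 R"
      by (intro eventually_finite_subsets_at_top_weakI conjI holomorphic_on_imp_continuous_on)
         (auto intro: holomorphic_on_subset[OF _ ball_subset_cball])
  qed auto
  then show "T holomorphic_on ball 0 R"
    unfolding T_def by (intro holomorphic_intros)
  show "\<wp> z = (\<Sum>u\<in>F. 1 / (z - u)\<^sup>2) + T z" if "z \<in> ball 0 R" for z
  proof -
    have F0: "0 \<in> F" using R by (auto simp: F_def)
    have "\<Lambda> - {0} = (F - {0}) \<union> (\<Lambda> - F)" using F0 by (auto simp: F_def)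
    then have "(\<Sum>\<^sub>\<infinity>u\<in>\<Lambda> - {0}. ?f u z) = (\<Sum>\<^sub>\<infinity>u\<in>(F - {0}) \<union> (\<Lambda> - F). ?f u z)" by simp
    also have "\<dots> = (\<Sum>\<^sub>\<infinity>u\<in>F - {0}. ?f u z) + (\<Sum>\<^sub>\<infinity>u\<in>\<Lambda> - F. ?f u z)"
      using F0 fin by (intro infsum_Un_disjoint summable_on_subset[OF summable_weierstrass_terms]) (auto simp: F_def)
    also have "(\<Sum>\<^sub>\<infinity>u\<in>F - {0}. ?f u z) = (\<Sum>u\<in>F - {0}. 1 / (z - u)\<^sup>2) - (\<Sum>u\<in>F - {0}. 1 / u\<^sup>2)"
      using fin by (simp add: sum_subtractf)
    finally show ?thesis
      unfolding weierstrass_p_def T_def using fin F0 by (simp add: sum.remove[of F 0])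
  qed
qed

lemma wp_analytic_off_lattice: assumes "z \<notin> \<Lambda>" shows "\<wp> analytic_on {z}"
proof -
  have R: "norm z + 1 > 0" by (simp add: add_nonneg_pos)
  obtain F T where F: "finite F" "F \<subseteq> \<Lambda>" "T holomorphic_on ball 0 (norm z + 1)"
    "\<And>x. x \<in> ball 0 (norm z + 1) \<Longrightarrow> \<wp> x = (\<Sum>u\<in>F. 1 / (x - u)\<^sup>2) + T x"
    using wp_local[OF R] by metis
  have "T analytic_on {z}"
    by (rule analytic_on_subset[of _ "ball 0 (norm z + 1)"]) (use F in \<open>auto simp: analytic_on_open\<close>)
  then have "(\<lambda>x. (\<Sum>u\<in>F. 1 / (x - u)\<^sup>2) + T x) analytic_on {z}"
    using F assms by (intro analytic_intros) auto
  also have "?this \<longleftrightarrow> ?thesis"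
  proof (rule analytic_at_cong)
    have "eventually (\<lambda>x. x \<in> ball 0 (norm z + 1)) (nhds z)"
      by (intro eventually_nhds_in_open) auto
    then show "\<forall>\<^sub>F x in nhds z. (\<Sum>u\<in>F. 1 / (x - u)\<^sup>2) + T x = \<wp> x"
      by eventually_elim (simp add: F)
  qed auto
  finally show ?thesis .
qed

lemma wp_analytic_at_lattice:
  assumes "v \<in> \<Lambda>"
  shows "(\<lambda>z. \<wp> z - 1 / (z - v)\<^sup>2) analytic_on {v}"
proof -
  have R: "norm v + 1 > 0" by (simp add: add_nonneg_pos)
  obtain F T where F: "finite F" "\<Lambda> \<inter> ball 0 (norm v + 1) \<subseteq> F" "T holomorphic_on ball 0 (norm v + 1)"
    "\<And>x. x \<in> ball 0 (norm v + 1) \<Longrightarrow> \<wp> x = (\<Sum>u\<in>F. 1 / (x - u)\<^sup>2) + T x"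
    using wp_local[OF R] by metis
  have vF: "v \<in> F" using F(2) assms by auto
  have "T analytic_on {v}"
    by (rule analytic_on_subset[of _ "ball 0 (norm v + 1)"]) (use F in \<open>auto simp: analytic_on_open\<close>)
  then have "(\<lambda>x. (\<Sum>u\<in>F - {v}. 1 / (x - u)\<^sup>2) + T x) analytic_on {v}"
    using F assms by (intro analytic_intros) auto
  also have "?this \<longleftrightarrow> ?thesis"
  proof (rule analytic_at_cong)
    have "eventually (\<lambda>x. x \<in> ball 0 (norm v + 1)) (nhds v)"
      by (intro eventually_nhds_in_open) auto
    then show "\<forall>\<^sub>F x in nhds v. (\<Sum>u\<in>F - {v}. 1 / (x - u)\<^sup>2) + T x = \<wp> x - 1 / (x - v)\<^sup>2"
      by eventually_elim (simp add: F sum.remove[OF F(1) vF])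
  qed auto
  finally show ?thesis .
qed

lemma wp_minus: "\<wp> (- z) = \<wp> z"
proof -
  have "(\<Sum>\<^sub>\<infinity>u\<in>\<Lambda> - {0}. (1 / (- z - u)\<^sup>2 - 1 / u\<^sup>2)) = (\<Sum>\<^sub>\<infinity>u\<in>\<Lambda> - {0}. (1 / (z - u)\<^sup>2 - 1 / u\<^sup>2))"
    by (rule infsum_reindex_bij_witness[of _ uminus uminus])
       (auto simp: power2_eq_square algebra_simps)
  then show ?thesis unfolding weierstrass_p_def by simp
qed

lemma wp_cnj: "\<wp> (cnj z) = cnj (\<wp> z)"
proof -
  have "(\<Sum>\<^sub>\<infinity>u\<in>\<Lambda> - {0}. (1 / (cnj z - u)\<^sup>2 - 1 / u\<^sup>2)) =
      cnj (\<Sum>\<^sub>\<infinity>u\<in>\<Lambda> - {0}. (1 / (z - u)\<^sup>2 - 1 / u\<^sup>2))"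
    unfolding infsum_cnj[symmetric]
    by (rule infsum_reindex_bij_witness[of _ cnj cnj]) auto
  then show ?thesis unfolding weierstrass_p_def by simp
qed

end

section \<open>Removable singularities and orders of zeros\<close>

lemma tendsto_divide_by_vanishing:
  fixes f :: "complex \<Rightarrow> complex"
  assumes f: "f meromorphic_on {z}" and lim: "(f \<longlongrightarrow> 0) (at z)"
  obtains l where "((\<lambda>x. f x / (x - z)) \<longlongrightarrow> l) (at z)"
proof
  \<comment> \<open>The value of \<open>f\<close> at \<open>z\<close> is arbitrary, so the
    difference quotient is formed with the analytic extension, whose value at \<open>z\<close> is
    0.\<close>
  define g where "g = remove_sings f"
  have iso: "isolated_singularity_at f z" using f by (simp add: meromorphic_at_iff)
  have "g analytic_on {z}" unfolding g_def using iso lim by (rule remove_sings_analytic_at)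
  then have "(g has_field_derivative deriv g z) (at z)"
    by (simp add: analytic_on_imp_differentiable_at DERIV_deriv_iff_field_differentiable)
  moreover have "g z = 0" unfolding g_def using lim by (rule remove_sings_eqI)
  ultimately have "((\<lambda>x. g x / (x - z)) \<longlongrightarrow> deriv g z) (at z)"
    by (simp add: has_field_derivative_iff)
  moreover have "eventually (\<lambda>x. g x / (x - z) = f x / (x - z)) (at z)"
    using eventually_remove_sings_eq_at[OF iso] by eventually_elim (simp add: g_def)
  ultimately show "((\<lambda>x. f x / (x - z)) \<longlongrightarrow> deriv g z) (at z)"
    by (rule Lim_transform_eventually)
qed

lemma filterlim_reflect_at: "filterlim (\<lambda>x. 2 * z - x) (at z) (at (z :: complex))"
proof -
  have "((\<lambda>x. 2 * z - x) \<longlongrightarrow> 2 * z - z) (at z)" by (intro tendsto_intros)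
  then show ?thesis
    by (intro filterlim_atI) (auto simp: eventually_at_filter)
qed

text \<open>A zero of a function that is even about \<open>z\<close> has order at least 2.\<close>

lemma tendsto_divide_square_by_vanishing_even:
  fixes f :: "complex \<Rightarrow> complex"
  assumes f: "f meromorphic_on {z}" and lim: "(f \<longlongrightarrow> 0) (at z)"
    and even: "\<And>x. f (2 * z - x) = f x"
  obtains l where "((\<lambda>x. f x / (x - z)\<^sup>2) \<longlongrightarrow> l) (at z)"
proof -
  obtain l where l: "((\<lambda>x. f x / (x - z)) \<longlongrightarrow> l) (at z)"
    using tendsto_divide_by_vanishing[OF f lim] .
  \<comment> \<open>The reflexion about \<open>z\<close> keeps the numerator and negates the
    denominator, so \<open>l = - l\<close>. Hence the quotient tends to 0 as well and can be divided
    once more.\<close>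
  have "((\<lambda>x. f (2 * z - x) / ((2 * z - x) - z)) \<longlongrightarrow> l) (at z)"
    by (rule filterlim_compose[OF l filterlim_reflect_at])
  moreover have "f (2 * z - x) / ((2 * z - x) - z) = - (f x / (x - z))" for x
    by (simp add: even) (metis minus_diff_eq minus_divide_right)
  ultimately have "((\<lambda>x. - (f x / (x - z))) \<longlongrightarrow> l) (at z)" by simp
  from tendsto_minus[OF this] have "((\<lambda>x. f x / (x - z)) \<longlongrightarrow> - l) (at z)" by simp
  with l have "l = - l" by (rule tendsto_unique[rotated]) simp
  then have "l = 0" by simp
  with l have l0: "((\<lambda>x. f x / (x - z)) \<longlongrightarrow> 0) (at z)" by simp
  have "(\<lambda>x. f x / (x - z)) meromorphic_on {z}"
    by (intro meromorphic_intros f) 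
  from tendsto_divide_by_vanishing[OF this l0] that show thesis
    by (auto simp: power2_eq_square)
qed

section \<open>Liouville's theorem and the periodicity of \<wp>\<close>

context rectangular_lattice
begin

text \<open>All values are already taken on a compact disc, so the function is bounded.\<close>

lemma entire_periodic_constant:
  assumes f: "f holomorphic_on UNIV" and per: "\<And>u z. u \<in> \<Lambda> \<Longrightarrow> f (z + u) = f z"
  shows "f z = f 0"
proof -
  have "compact (f ` cball 0 (\<alpha> + \<beta>))"
    using f by (intro compact_continuous_image holomorphic_on_imp_continuous_on)
               (auto intro: holomorphic_on_subset)
  moreover have "range f \<subseteq> f ` cball 0 (\<alpha> + \<beta>)"
  proof
    fix y assume "y \<in> range f"
    then obtain z where "y = f z" by auto
    moreover obtain u where "u \<in> \<Lambda>" "norm (z - u) \<le> \<alpha> + \<beta>" by (rule lattice_reduce)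
    ultimately show "y \<in> f ` cball 0 (\<alpha> + \<beta>)"
      using per[of u "z - u"] by (auto intro!: image_eqI[of _ _ "z - u"])
  qed
  ultimately have "bounded (range f)"
    using compact_imp_bounded bounded_subset by blast
  then have "f constant_on UNIV" by (rule Liouville_theorem[OF f])
  then show ?thesis by (auto simp: constant_on_def)
qed

text \<open>The singularities are filled in before Liouville's theorem is applied; periodicity
  survives because the filled-in values are limits. The values of \<open>f\<close> itself at
  isolated points stay free, so constancy is asserted on punctured neighbourhoods.\<close>

lemma meromorphic_periodic_constant:
  assumes f: "f meromorphic_on UNIV" and per: "\<And>u z. u \<in> \<Lambda> \<Longrightarrow> f (z + u) = f z"
    and lim: "\<And>z. \<exists>l. (f \<longlongrightarrow> l) (at z)"
  obtains c where "\<And>z. \<forall>\<^sub>F x in at z. f x = c"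
proof -
  define g where "g = remove_sings f"
  have iso: "isolated_singularity_at f z" for z
    using f by (auto simp: meromorphic_on_altdef)
  have "g analytic_on {z}" for z
    unfolding g_def using iso lim remove_sings_analytic_at by blast
  then have hol: "g holomorphic_on UNIV"
    using analytic_on_analytic_at analytic_imp_holomorphic by blast
  have "g (z + u) = g z" if u: "u \<in> \<Lambda>" for z u
  proof -
    obtain l l' where l: "(f \<longlongrightarrow> l) (at z)" and l': "(f \<longlongrightarrow> l') (at (z + u))"
      using lim by metis
    have "((\<lambda>x. f (x + u)) \<longlongrightarrow> l') (at z)" using LIM_offset[OF l', of u] by simp
    then have "l = l'" using l tendsto_unique[of "at z" f l l'] by (simp add: per[OF u])
    then show ?thesis using l l' remove_sings_eqI by (metis g_def)
  qed
  with hol have const: "g z = g 0" for z by (rule entire_periodic_constant)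
  show thesis
  proof (rule that)
    show "\<forall>\<^sub>F x in at z. f x = g 0" for z
      using eventually_remove_sings_eq_at[OF iso[of z]]
      by eventually_elim (metis const g_def)
  qed
qed

text \<open>At \<open>v = 0\<close> the second summand is 0, as \<open>1 / 0 = 0\<close>.\<close>

lemma wp_has_sum: "((\<lambda>v. 1 / (z - v)\<^sup>2 - 1 / v\<^sup>2) has_sum \<wp> z) \<Lambda>"
proof -
  have "((\<lambda>v. 1 / (z - v)\<^sup>2 - 1 / v\<^sup>2) has_sum
      (\<Sum>\<^sub>\<infinity>u\<in>\<Lambda> - {0}. (1 / (z - u)\<^sup>2 - 1 / u\<^sup>2))) (\<Lambda> - {0})"
    by (rule has_sum_infsum[OF summable_weierstrass_terms])
  moreover have "((\<lambda>v. 1 / (z - v)\<^sup>2 - 1 / v\<^sup>2) has_sum (1 / z\<^sup>2)) {0}"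
    using has_sum_finite[of "{0}" "\<lambda>v. 1 / (z - v)\<^sup>2 - 1 / v\<^sup>2"] by simp
  ultimately have "((\<lambda>v. 1 / (z - v)\<^sup>2 - 1 / v\<^sup>2) has_sum \<wp> z) ({0} \<union> (\<Lambda> - {0}))"
    unfolding weierstrass_p_def by (intro has_sum_Un_disjoint) auto
  moreover have "{0} \<union> (\<Lambda> - {0}) = \<Lambda>" using lattice_0 by blast
  ultimately show ?thesis by (simp only:)
qed

text \<open>
  The difference of \<open>\<wp>\<close> and its translate is a series without the subtracted constants, so
  it is periodic by reindexing, hence constant, and evenness of \<open>\<wp>\<close> makes it vanish at
  \<open>- u / 2\<close>.
\<close>

lemma wp_periodic_half:
  assumes u: "u \<in> \<Lambda>" and half: "u / 2 \<notin> \<Lambda>"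
  shows "\<wp> (z + u) = \<wp> z"
proof -
  define D where "D = (\<lambda>z. \<wp> (z + u) - \<wp> z)"
  have sum: "((\<lambda>v. 1 / (z + u - v)\<^sup>2 - 1 / (z - v)\<^sup>2) has_sum D z) \<Lambda>" for z
  proof -
    have "((\<lambda>v. - (1 / (z - v)\<^sup>2 - 1 / v\<^sup>2)) has_sum - \<wp> z) \<Lambda>"
      by (subst has_sum_uminus) (simp only: minus_minus wp_has_sum)
    from has_sum_add[OF wp_has_sum[of "z + u"] this] show ?thesis
      unfolding D_def by (simp only: add_uminus_conv_diff diff_diff_eq2 diff_add_cancel)
  qed
  have per: "D (z + w) = D z" if w: "w \<in> \<Lambda>" for w z
  proof (rule has_sum_unique)
    show "((\<lambda>v. 1 / (z + u - v)\<^sup>2 - 1 / (z - v)\<^sup>2) has_sum D z) \<Lambda>" by (rule sum)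
    have "((\<lambda>v. 1 / (z + w + u - v)\<^sup>2 - 1 / (z + w - v)\<^sup>2) has_sum D (z + w)) \<Lambda>" by (rule sum)
    also have "?this \<longleftrightarrow> ((\<lambda>v. 1 / (z + u - v)\<^sup>2 - 1 / (z - v)\<^sup>2) has_sum D (z + w)) \<Lambda>"
      by (rule has_sum_reindex_bij_witness[of _ "\<lambda>v. v + w" "\<lambda>v. v - w"])
         (use w in \<open>simp_all add: lattice_add lattice_diff add.commute add.left_commute diff_diff_eq2 flip: diff_diff_eq\<close>)
    finally show "((\<lambda>v. 1 / (z + u - v)\<^sup>2 - 1 / (z - v)\<^sup>2) has_sum D (z + w)) \<Lambda>" .
  qed
  have "D analytic_on {z}" for z
  proof (cases "z \<in> \<Lambda>")
    case True
    \<comment> \<open>At a lattice point both terms of \<open>D\<close> have a pole, but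
      \<open>1 / (x + u - (z + u))\<^sup>2\<close> equals \<open>1 / (x - z)\<^sup>2\<close>, so the
      principal parts cancel.\<close>
    have "(\<lambda>x. \<wp> x - 1 / (x - (z + u))\<^sup>2) \<circ> (\<lambda>x. x + u) analytic_on {z}"
      using True u by (intro analytic_on_compose_gen[of _ _ _ "{z + u}"] wp_analytic_at_lattice analytic_intros lattice_add) auto
    from analytic_on_diff[OF this wp_analytic_at_lattice[OF True]]
    show ?thesis by (simp add: D_def o_def)
  next
    case False
    then have "\<wp> \<circ> (\<lambda>x. x + u) analytic_on {z}"
      using u by (intro analytic_on_compose_gen[of _ _ _ "{z + u}"] wp_analytic_off_lattice analytic_intros)
        (auto simp: lattice_add_iff)
    from analytic_on_diff[OF this wp_analytic_off_lattice[OF False]]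
    show ?thesis by (simp add: D_def o_def)
  qed
  then have "D holomorphic_on UNIV"
    using analytic_on_analytic_at analytic_imp_holomorphic by blast
  from entire_periodic_constant[OF this per] have "D z = D (- (u / 2))" by metis
  also have "D (- (u / 2)) = 0" using wp_minus[of "u / 2"] by (simp add: D_def)
  finally show ?thesis by (simp add: D_def)
qed

lemma half_lattice_iff:
  "Complex (x * \<alpha> / 2) (y * \<beta> / 2) \<in> \<Lambda> \<longleftrightarrow> (\<exists>m n :: int. x = 2 * of_int m \<and> y = 2 * of_int n)"
proof -
  have "x * a / 2 = of_int m * a \<longleftrightarrow> x = 2 * of_int m" if "a > 0" for x a :: real and m :: int
  proof -
    have "x * a / 2 = of_int m * a \<longleftrightarrow> x * a = (2 * of_int m) * a" by linarith
    then show ?thesis using that by simp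
  qed
  with pos show ?thesis by (simp only: lattice_iff complex.inject)
qed

lemma half_periods:
  "complex_of_real \<alpha> / 2 \<notin> \<Lambda>" "complex_of_real \<beta> * \<i> / 2 \<notin> \<Lambda>"
  "(complex_of_real \<alpha> + complex_of_real \<beta> * \<i>) / 2 \<notin> \<Lambda>"
proof -
  have odd: "1 \<noteq> 2 * real_of_int m" for m
  proof
    assume "1 = 2 * real_of_int m"
    then have "1 = 2 * m" by linarith
    then show False by presburger
  qed
  have eq: "complex_of_real \<alpha> / 2 = Complex (1 * \<alpha> / 2) (0 * \<beta> / 2)"
    "complex_of_real \<beta> * \<i> / 2 = Complex (0 * \<alpha> / 2) (1 * \<beta> / 2)"
    "(complex_of_real \<alpha> + complex_of_real \<beta> * \<i>) / 2 = Complex (1 * \<alpha> / 2) (1 * \<beta> / 2)"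
    by (simp_all add: complex_eq_iff)
  show "complex_of_real \<alpha> / 2 \<notin> \<Lambda>" "complex_of_real \<beta> * \<i> / 2 \<notin> \<Lambda>"
    "(complex_of_real \<alpha> + complex_of_real \<beta> * \<i>) / 2 \<notin> \<Lambda>"
    unfolding eq half_lattice_iff using odd by auto
qed

text \<open>The halves of the two generators lie off the lattice by parity, so the half-period
  argument covers the generators and with them all periods.\<close>

lemma wp_periodic:
  assumes "u \<in> \<Lambda>"
  shows "\<wp> (z + u) = \<wp> z"
proof (rule lattice_periodic[of \<wp> u z])
  show "\<wp> (z + complex_of_real \<alpha>) = \<wp> z" for z
    by (rule wp_periodic_half[OF lattice_generators(1) half_periods(1)])
  show "\<wp> (z + complex_of_real \<beta> * \<i>) = \<wp> z" for z
    by (rule wp_periodic_half[OF lattice_generators(2) half_periods(2)])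
qed (rule assms)

lemma wp_meromorphic: "\<wp> meromorphic_on UNIV"
proof -
  have "\<wp> meromorphic_on {z}" for z
  proof (cases "z \<in> \<Lambda>")
    case True
    have "(\<lambda>x. (\<wp> x - 1 / (x - z)\<^sup>2) + 1 / (x - z)\<^sup>2) meromorphic_on {z}"
      by (intro meromorphic_intros analytic_on_imp_meromorphic_on wp_analytic_at_lattice True)
    then show ?thesis by simp
  qed (auto intro: analytic_on_imp_meromorphic_on wp_analytic_off_lattice)
  then show ?thesis by (subst meromorphic_on_meromorphic_at) auto
qed

lemma wp_at_lattice:
  assumes "v \<in> \<Lambda>"
  shows "filterlim \<wp> at_infinity (at v)"
proof -
  have "(\<lambda>z. \<wp> z - 1 / (z - v)\<^sup>2) \<midarrow>v\<rightarrow> \<wp> v - 1 / (v - v)\<^sup>2"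
    using analytic_at_imp_isCont[OF wp_analytic_at_lattice[OF assms]] by (simp add: isCont_def)
  moreover have "filterlim (\<lambda>z. 1 / (z - v)\<^sup>2) at_infinity (at v)"
    by (intro filterlim_divide_at_infinity[of _ 1] tendsto_const filterlim_atI)
       (auto intro!: tendsto_eq_intros simp: eventually_at_filter)
  ultimately have "filterlim (\<lambda>z. (\<wp> z - 1 / (z - v)\<^sup>2) + 1 / (z - v)\<^sup>2) at_infinity (at v)"
    by (rule tendsto_add_filterlim_at_infinity)
  then show ?thesis by simp
qed

section \<open>Translation by the half period \<omega>\<close>

abbreviation center ("\<omega>") where "\<omega> \<equiv> (complex_of_real \<alpha> + complex_of_real \<beta> * \<i>) / 2"

lemma two_center: "2 * \<omega> \<in> \<Lambda>"
  using lattice_add[OF lattice_generators] by simp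

text \<open>The zero of the second factor at \<open>v\<close> is double because this factor is even
  about \<open>v\<close>: modulo \<Lambda>, the map \<open>x \<mapsto> 2 * v - x\<close> sends
  \<open>x + \<omega>\<close> to \<open>- (x + \<omega>)\<close>, and \<wp> is even.\<close>

lemma wp_translate_product_tendsto:
  assumes v: "v \<in> \<Lambda>"
  shows "\<exists>l. ((\<lambda>x. (\<wp> x - \<wp> \<omega>) * (\<wp> (x + \<omega>) - \<wp> \<omega>)) \<longlongrightarrow> l) (at v)"
proof -
  let ?k = "\<lambda>x. \<wp> (x + \<omega>) - \<wp> \<omega>"
  have "\<wp> \<circ> (\<lambda>x. x + \<omega>) analytic_on {v}"
    using half_periods(3) lattice_add_iff[OF v, of \<omega>]
    by (intro analytic_on_compose_gen[of _ _ _ "{v + \<omega>}"] wp_analytic_off_lattice analytic_intros)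
       (simp_all add: add.commute)
  then have k: "?k analytic_on {v}" by (intro analytic_intros) (simp add: o_def)
  have "?k v = 0" using wp_periodic[OF v, of \<omega>] by (simp add: add.commute)
  then have k0: "(?k \<longlongrightarrow> 0) (at v)"
    using analytic_at_imp_isCont[OF k] by (simp add: isCont_def)
  have even: "?k (2 * v - x) = ?k x" for x
  proof -
    have "- (2 * v + 2 * \<omega>) \<in> \<Lambda>"
      using lattice_add[OF lattice_add[OF v v] two_center] by (simp only: lattice_minus_iff mult_2)
    moreover have "x + w + - (2 * v + 2 * w) = - (2 * v - x + w)" for w :: complex
      by (simp add: algebra_simps)
    ultimately have "\<wp> (x + \<omega>) = \<wp> (- (2 * v - x + \<omega>))"
      using wp_periodic by metis
    then show ?thesis by (simp only: wp_minus)
  qed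
  obtain l where l: "((\<lambda>x. ?k x / (x - v)\<^sup>2) \<longlongrightarrow> l) (at v)"
    using tendsto_divide_square_by_vanishing_even[OF analytic_on_imp_meromorphic_on[OF k] k0 even] .
  have "((\<lambda>x. \<wp> x - 1 / (x - v)\<^sup>2) \<longlongrightarrow> \<wp> v - 1 / (v - v)\<^sup>2) (at v)"
    using analytic_at_imp_isCont[OF wp_analytic_at_lattice[OF v]] by (simp add: isCont_def)
  \<comment> \<open>The first factor is split into its regular part at \<open>v\<close> and
    \<open>1 / (x - v)\<^sup>2\<close>; the latter is absorbed by the double zero.\<close>
  then have "((\<lambda>x. ((\<wp> x - 1 / (x - v)\<^sup>2) - \<wp> \<omega>) * ?k x + ?k x / (x - v)\<^sup>2) \<longlongrightarrow>
      ((\<wp> v - 1 / (v - v)\<^sup>2) - \<wp> \<omega>) * 0 + l) (at v)"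
    by (intro tendsto_add tendsto_mult tendsto_diff[OF _ tendsto_const] k0 l)
  moreover have "((\<wp> x - 1 / (x - v)\<^sup>2) - \<wp> \<omega>) * ?k x + ?k x / (x - v)\<^sup>2 = (\<wp> x - \<wp> \<omega>) * ?k x" for x
    by (simp add: left_diff_distrib)
  ultimately have "((\<lambda>x. (\<wp> x - \<wp> \<omega>) * ?k x) \<longlongrightarrow> ((\<wp> v - 1 / (v - v)\<^sup>2) - \<wp> \<omega>) * 0 + l) (at v)"
    by (simp only:)
  then show ?thesis by (rule exI)
qed

text \<open>Only \<open>K \<noteq> 0\<close> is recorded: the expression of \<open>K\<close> by e1,
  e2, e3 says nothing about vanishing until these are known to differ, and that will be deduced from
  \<open>K \<noteq> 0\<close>.\<close>

lemma wp_translate_product: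
  obtains K where "K \<noteq> 0"
    "\<And>z. z \<notin> \<Lambda> \<Longrightarrow> z + \<omega> \<notin> \<Lambda> \<Longrightarrow> (\<wp> z - \<wp> \<omega>) * (\<wp> (z + \<omega>) - \<wp> \<omega>) = K"
proof -
  define h where "h = (\<lambda>x. (\<wp> x - \<wp> \<omega>) * (\<wp> (x + \<omega>) - \<wp> \<omega>))"
  have shift: "\<wp> (x + \<omega> + \<omega>) = \<wp> x" for x
    using wp_periodic[OF two_center, of x] by (simp add: add.assoc)
  have an: "h analytic_on {z}" if "z \<notin> \<Lambda>" "z + \<omega> \<notin> \<Lambda>" for z
  proof -
    have "\<wp> \<circ> (\<lambda>x. x + \<omega>) analytic_on {z}"
      using that by (intro analytic_on_compose_gen[of _ _ _ "{z + \<omega>}"] wp_analytic_off_lattice analytic_intros) auto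
    then show ?thesis unfolding h_def
      by (intro analytic_intros wp_analytic_off_lattice that) (simp add: o_def)
  qed
  have mero: "h meromorphic_on UNIV"
  proof -
    have "(\<lambda>x. \<wp> (x + \<omega>)) meromorphic_on UNIV"
      by (rule meromorphic_on_compose[OF wp_meromorphic]) (auto intro!: analytic_intros)
    then show ?thesis unfolding h_def by (intro meromorphic_intros wp_meromorphic)
  qed
  have lim: "\<exists>l. (h \<longlongrightarrow> l) (at z)" for z
  proof -
    consider "z \<in> \<Lambda>" | "z + \<omega> \<in> \<Lambda>" | "z \<notin> \<Lambda>" "z + \<omega> \<notin> \<Lambda>" by blast
    then show ?thesis
    proof cases
      case 1
      then show ?thesis unfolding h_def by (rule wp_translate_product_tendsto)
    next
      case 2
      \<comment> \<open>Translation by \<omega> interchanges the two factors of \<open>h\<close>,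
        because \<open>2 * \<omega>\<close> is a period; so these points reduce to lattice
        points.\<close>
      then obtain l where "(h \<longlongrightarrow> l) (at (z + \<omega>))"
        using wp_translate_product_tendsto unfolding h_def by blast
      from LIM_offset[OF this, of \<omega>] have "((\<lambda>x. h (x + \<omega>)) \<longlongrightarrow> l) (at z)" by simp
      moreover have "h (x + \<omega>) = h x" for x unfolding h_def shift by (rule mult.commute)
      ultimately show ?thesis by auto
    next
      case 3
      then show ?thesis using analytic_at_imp_isCont[OF an] by (auto simp: isCont_def)
    qed
  qed
  have per: "h (z + u) = h z" if "u \<in> \<Lambda>" for z u
  proof -
    have "z + u + \<omega> = z + \<omega> + u" by (simp only: ac_simps)
    then show ?thesis unfolding h_def by (simp only: wp_periodic[OF that])
  qed
  obtain K where K: "\<And>z. \<forall>\<^sub>F x in at z. h x = K"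
    using meromorphic_periodic_constant[OF mero per lim] by blast
  show thesis
  proof (rule that)
    show "(\<wp> z - \<wp> \<omega>) * (\<wp> (z + \<omega>) - \<wp> \<omega>) = K" if "z \<notin> \<Lambda>" "z + \<omega> \<notin> \<Lambda>" for z
    proof -
      have "(h \<longlongrightarrow> h z) (at z)" using analytic_at_imp_isCont[OF an[OF that]] by (simp add: isCont_def)
      moreover have "(h \<longlongrightarrow> K) (at z)" using K by (rule tendsto_eventually)
      ultimately have "h z = K" using tendsto_unique[of "at z"] by simp
      then show ?thesis by (simp add: h_def)
    qed
    show "K \<noteq> 0"
    proof
      \<comment> \<open>Near 0 the first factor is nonzero because of the pole, so the second one
        would vanish there and \<wp> would be constant near \<omega>. A meromorphic function on the
        plane would then have this constant value near 0 too, against the pole.\<close>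
      assume "K = 0"
      have ne: "\<forall>\<^sub>F x in at 0. \<wp> x \<noteq> \<wp> \<omega>"
        using wp_at_lattice[OF lattice_0] filterlim_at_infinity_imp_eventually_ne by blast
      from K[of 0] ne have eq: "\<forall>\<^sub>F x in at 0. \<wp> (x + \<omega>) = \<wp> \<omega>"
        by eventually_elim (simp add: h_def \<open>K = 0\<close>)
      from meromorphic_imp_constant_or_avoid[OF wp_meromorphic, of "\<wp> \<omega>"]
      consider "\<forall>\<^sub>F x in at 0. \<wp> x = \<wp> \<omega>" | "\<forall>\<^sub>F x in at \<omega>. \<wp> x \<noteq> \<wp> \<omega>"
        by (auto simp: eventually_cosparse_open_eq)
      then show False
      proof cases
        case 1
        with ne have "\<forall>\<^sub>F x in at (0::complex). False" by eventually_elim simp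
        then show False by (simp add: trivial_limit_def[symmetric])
      next
        case 2
        then have "\<forall>\<^sub>F x in at 0. \<wp> (x + \<omega>) \<noteq> \<wp> \<omega>"
          by (subst (asm) at_to_0) (simp add: eventually_filtermap)
        with eq have "\<forall>\<^sub>F x in at (0::complex). False" by eventually_elim simp
        then show False by (simp add: trivial_limit_def[symmetric])
      qed
    qed
  qed
qed

lemma wp_eq_center_value_imp:
  assumes "z \<notin> \<Lambda>" "\<wp> z = \<wp> \<omega>" shows "z + \<omega> \<in> \<Lambda>"
proof (rule ccontr)
  obtain K where K: "K \<noteq> 0"
    "\<And>z. z \<notin> \<Lambda> \<Longrightarrow> z + \<omega> \<notin> \<Lambda> \<Longrightarrow> (\<wp> z - \<wp> \<omega>) * (\<wp> (z + \<omega>) - \<wp> \<omega>) = K"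
    using wp_translate_product by blast
  assume "z + \<omega> \<notin> \<Lambda>"
  from K(2)[OF assms(1) this] K(1) assms(2) show False by simp
qed

section \<open>Reality and order of the values at the half periods\<close>

lemma wp_real:
  assumes "cnj z = z + u \<or> cnj z = - z + u" "u \<in> \<Lambda>" shows "\<wp> z \<in> \<real>"
proof -
  have "\<wp> (cnj z) = \<wp> z" using assms wp_periodic wp_minus by metis
  then show ?thesis by (simp add: wp_cnj Reals_cnj_iff)
qed

lemma wp_half_period_real:
  "\<wp> (complex_of_real \<alpha> / 2) \<in> \<real>" "\<wp> (complex_of_real \<beta> * \<i> / 2) \<in> \<real>" "\<wp> \<omega> \<in> \<real>"
proof -
  show "\<wp> (complex_of_real \<alpha> / 2) \<in> \<real>" "\<wp> (complex_of_real \<beta> * \<i> / 2) \<in> \<real>"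
    by (rule wp_real[of _ 0]; simp)+
  show "\<wp> \<omega> \<in> \<real>"
  proof (rule wp_real)
    show "- (complex_of_real \<beta> * \<i>) \<in> \<Lambda>"
      using lattice_generators(2) by (rule lattice_minus)
    show "cnj \<omega> = \<omega> + - (complex_of_real \<beta> * \<i>) \<or> cnj \<omega> = - \<omega> + - (complex_of_real \<beta> * \<i>)"
      by (simp add: complex_eq_iff)
  qed
qed

text \<open>
  Along the axis spanned by \<open>d\<close> the real function \<open>\<wp>\<close> starts at an infinity of the sign of
  \<open>1 / d\<^sup>2\<close> and cannot cross the value \<open>\<wp> \<omega>\<close>.
\<close>

lemma wp_axis:
  fixes d :: complex and T :: real
  assumes T: "T > 0" and d: "d = 1 \<or> d = \<i>"
    and off: "\<And>t. 0 < t \<Longrightarrow> t \<le> T \<Longrightarrow> of_real t * d \<notin> \<Lambda> \<and> of_real t * d + \<omega> \<notin> \<Lambda>"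
  shows "Re (1 / d\<^sup>2) * (Re (\<wp> (of_real T * d)) - Re (\<wp> \<omega>)) > 0"
proof (rule ccontr)
  \<comment> \<open>The factor \<open>Re (1 / d\<^sup>2)\<close> is 1 on the real and -1 on the
    imaginary axis; it makes \<psi> tend to plus infinity at 0 in both cases.\<close>
  define \<psi> where "\<psi> = (\<lambda>t::real. Re (1 / d\<^sup>2) * (Re (\<wp> (of_real t * d)) - Re (\<wp> \<omega>)))"
  assume "\<not> Re (1 / d\<^sup>2) * (Re (\<wp> (of_real T * d)) - Re (\<wp> \<omega>)) > 0"
  then have neg: "\<psi> T \<le> 0" by (simp add: \<psi>_def)
  have nz: "\<psi> t \<noteq> 0" if "0 < t" "t \<le> T" for t
  proof
    assume "\<psi> t = 0"
    then have "Re (\<wp> (of_real t * d)) = Re (\<wp> \<omega>)" using d by (auto simp: \<psi>_def)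
    moreover have "\<wp> (of_real t * d) \<in> \<real>" using d by (intro wp_real[of _ 0]) auto
    ultimately have "\<wp> (of_real t * d) = \<wp> \<omega>"
      using wp_half_period_real(3) by (simp add: complex_eq_iff complex_is_Real_iff)
    then show False using off[OF that] wp_eq_center_value_imp by blast
  qed
  have ax: "filterlim (\<lambda>t::real. of_real t * d) (at 0) (at_right 0)"
    using d by (intro filterlim_atI) (auto intro!: tendsto_eq_intros simp: eventually_at_filter)
  have "((\<lambda>x. \<wp> x - 1 / (x - 0)\<^sup>2) \<longlongrightarrow> \<wp> 0 - 1 / (0 - 0)\<^sup>2) (at 0)"
    using analytic_at_imp_isCont[OF wp_analytic_at_lattice[OF lattice_0]] by (simp add: isCont_def)
  from filterlim_compose[OF this ax]
  have "((\<lambda>t. Re (1 / d\<^sup>2) * (Re (\<wp> (of_real t * d) - 1 / (of_real t * d - 0)\<^sup>2) - Re (\<wp> \<omega>))) \<longlongrightarrow>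
      Re (1 / d\<^sup>2) * (Re (\<wp> 0 - 1 / (0 - 0)\<^sup>2) - Re (\<wp> \<omega>))) (at_right 0)"
    by (intro tendsto_mult tendsto_const tendsto_diff[OF tendsto_Re])
  moreover have "filterlim (\<lambda>t::real. 1 / t ^ 2) at_top (at_right 0)" by real_asymp
  ultimately have "filterlim (\<lambda>t. Re (1 / d\<^sup>2) * (Re (\<wp> (of_real t * d) - 1 / (of_real t * d - 0)\<^sup>2) - Re (\<wp> \<omega>)) + 1 / t ^ 2)
      at_top (at_right 0)"
    by (rule filterlim_tendsto_add_at_top)
  moreover have "Re (1 / d\<^sup>2) * (Re (\<wp> (of_real t * d) - 1 / (of_real t * d - 0)\<^sup>2) - Re (\<wp> \<omega>)) + 1 / t ^ 2 = \<psi> t" for t :: real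
  proof -
    have "Re (1 / d\<^sup>2) * Re (1 / (of_real t * d - 0)\<^sup>2) = 1 / t ^ 2"
      using d by (auto simp: power_mult_distrib Re_divide power2_eq_square)
    then show ?thesis by (simp add: \<psi>_def right_diff_distrib)
  qed
  ultimately have "filterlim \<psi> at_top (at_right 0)" by (simp only:)
  then have "\<forall>\<^sub>F t in at_right 0. \<psi> t > 0" by (simp add: filterlim_at_top_dense)
  moreover have "\<forall>\<^sub>F t in at_right 0. t \<in> {0<..<T}" using T by (rule eventually_at_right_real)
  ultimately have "\<forall>\<^sub>F t in at_right 0. 0 < t \<and> t < T \<and> \<psi> t > 0" by eventually_elim simp
  then obtain t0 where t0: "0 < t0" "t0 < T" "\<psi> t0 > 0"
    using eventually_happens'[of "at_right (0::real)"] by auto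
  have "continuous_on {t0..T} \<psi>"
  proof -
    have "continuous_on {t0..T} (\<lambda>t. \<wp> (of_real t * d))"
    proof (rule continuous_on_compose2[of "- \<Lambda>" \<wp>])
      show "continuous_on (- \<Lambda>) \<wp>"
        by (intro continuous_at_imp_continuous_on ballI analytic_at_imp_isCont wp_analytic_off_lattice) auto
      show "(\<lambda>t. of_real t * d) ` {t0..T} \<subseteq> - \<Lambda>" using off t0 by auto
    qed (intro continuous_intros)
    then show ?thesis unfolding \<psi>_def by (intro continuous_intros)
  qed
  then obtain t where "t0 \<le> t" "t \<le> T" "\<psi> t = 0"
    using IVT2'[of \<psi> T 0 t0] neg t0 by auto
  then show False using nz t0 by auto
qed

lemma wp_half_period_order:
  "Re (\<wp> (complex_of_real \<alpha> / 2)) > Re (\<wp> \<omega>)" "Re (\<wp> \<omega>) > Re (\<wp> (complex_of_real \<beta> * \<i> / 2))"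
proof -
  \<comment> \<open>This is applied to \<open>t\<close> along the axis, and to half a side for the
    other coordinate, which is where adding \<omega> puts the point off the lattice.\<close>
  have no: "t \<noteq> of_int m * a" if "0 < t" "t \<le> a / 2" for t a :: real and m :: int
  proof
    assume eq: "t = of_int m * a"
    have a: "a > 0" using that by linarith
    have "0 < of_int m * a" "of_int m * a < 1 * a" using eq that a by linarith+
    then have "0 < (of_int m :: real)" "(of_int m :: real) < 1"
      using a by (simp_all only: zero_less_mult_pos2 mult_less_cancel_right_disj) auto
    then show False by simp
  qed
  have "of_real t * 1 \<notin> \<Lambda> \<and> of_real t * 1 + \<omega> \<notin> \<Lambda>" if "0 < t" "t \<le> \<alpha> / 2" for t
    using no[OF that] no[of "\<beta> / 2" \<beta>] pos by (auto simp: lattice_iff complex_eq_iff)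
  from wp_axis[of "\<alpha> / 2" 1, OF _ _ this] pos
  show "Re (\<wp> (complex_of_real \<alpha> / 2)) > Re (\<wp> \<omega>)" by simp
  have "of_real t * \<i> \<notin> \<Lambda> \<and> of_real t * \<i> + \<omega> \<notin> \<Lambda>" if "0 < t" "t \<le> \<beta> / 2" for t
    using no[OF that] no[of "\<alpha> / 2" \<alpha>] pos by (auto simp: lattice_iff complex_eq_iff)
  from wp_axis[of "\<beta> / 2" \<i>, OF _ _ this] pos
  show "Re (\<wp> \<omega>) > Re (\<wp> (complex_of_real \<beta> * \<i> / 2))" by simp
qed

end

section \<open>Even elliptic functions\<close>

lemma meromorphic_on_poly:
  "f meromorphic_on A \<Longrightarrow> (\<lambda>x. poly p (f x)) meromorphic_on A"
  by (induction p) (auto intro!: meromorphic_intros)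

text \<open>With \<open>n\<close> the order of \<open>f\<close> at \<open>z\<close>, the power
  \<open>\<bar>n\<bar>\<close> leaves the exponent \<open>\<bar>n\<bar> + n \<ge> 0\<close>, so
  zeros and poles are handled alike. A function that vanishes near \<open>z\<close> is treated
  apart, with exponent 0.\<close>

lemma meromorphic_order_finite:
  assumes "f meromorphic_on {z}"
  obtains N :: nat and l where "((\<lambda>x. (x - z) ^ N * f x) \<longlongrightarrow> l) (at z)"
proof (cases "\<exists>\<^sub>F w in at z. f w \<noteq> 0")
  case False
  then have "\<forall>\<^sub>F w in at z. (w - z) ^ 0 * f w = 0" by (simp add: frequently_def)
  then show thesis by (intro that[of 0 0] tendsto_eventually)
next
  case True
  define g n where "g = zor_poly f z" and "n = zorder f z"
  obtain r where r: "r > 0" "g holomorphic_on cball z r"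
    "\<And>w. w \<in> cball z r - {z} \<Longrightarrow> f w = g w * (w - z) powi n"
    using zorder_exist[OF _ _ True] assms unfolding g_def n_def meromorphic_at_iff by blast
  have "g analytic_on {z}"
    by (rule analytic_on_subset[of _ "ball z r"])
       (use r holomorphic_on_subset[OF r(2) ball_subset_cball] in \<open>auto simp: analytic_on_open\<close>)
  then have "(g \<longlongrightarrow> g z) (at z)" using analytic_at_imp_isCont by (auto simp: isCont_def)
  then have "((\<lambda>w. (w - z) ^ nat (\<bar>n\<bar> + n) * g w) \<longlongrightarrow> (z - z) ^ nat (\<bar>n\<bar> + n) * g z) (at z)"
    by (intro tendsto_intros)
  moreover have "\<forall>\<^sub>F w in at z. w \<in> cball z r - {z}"
    using eventually_at_in_open[of "ball z r" z] r(1)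
    by (auto elim!: eventually_mono)
  then have "\<forall>\<^sub>F w in at z. (w - z) ^ nat (\<bar>n\<bar> + n) * g w = (w - z) ^ nat \<bar>n\<bar> * f w"
  proof eventually_elim
    case (elim w)
    have "(w - z) ^ nat (\<bar>n\<bar> + n) = (w - z) powi (\<bar>n\<bar> + n)"
      by (simp add: power_int_def)
    also have "\<dots> = (w - z) powi \<bar>n\<bar> * (w - z) powi n"
      using elim by (intro power_int_add) auto
    also have "(w - z) powi \<bar>n\<bar> = (w - z) ^ nat \<bar>n\<bar>" by (simp add: power_int_def)
    finally show ?case using r(3)[OF elim] by (simp add: mult_ac)
  qed
  ultimately show thesis by (intro that) (rule Lim_transform_eventually)
qed

section \<open>The normalised function \<open>W\<close>\<close>

context rectangular_lattice
begin

definition scale :: complex ("\<sigma>") where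
  "\<sigma> = csqrt ((\<wp> (complex_of_real \<alpha> / 2) - \<wp> \<omega>) * (\<wp> \<omega> - \<wp> (complex_of_real \<beta> * \<i> / 2)))"

definition W :: "complex \<Rightarrow> complex" where "W z = (\<wp> z - \<wp> \<omega>) / \<sigma>"

lemma scale_square:
  "\<sigma>\<^sup>2 = (\<wp> (complex_of_real \<alpha> / 2) - \<wp> \<omega>) * (\<wp> \<omega> - \<wp> (complex_of_real \<beta> * \<i> / 2))"
  unfolding scale_def by (rule power2_csqrt)

lemma scale_nonzero: "\<sigma> \<noteq> 0"
  using wp_half_period_order by (auto simp: scale_def)

lemma scale_real: "cnj \<sigma> = \<sigma>"
proof -
  define x where "x = (Re (\<wp> (complex_of_real \<alpha> / 2)) - Re (\<wp> \<omega>)) * (Re (\<wp> \<omega>) - Re (\<wp> (complex_of_real \<beta> * \<i> / 2)))"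
  have "x \<ge> 0" unfolding x_def using wp_half_period_order by simp
  moreover have "(\<wp> (complex_of_real \<alpha> / 2) - \<wp> \<omega>) * (\<wp> \<omega> - \<wp> (complex_of_real \<beta> * \<i> / 2)) = of_real x"
    using wp_half_period_real unfolding x_def complex_is_Real_iff
    by (simp add: complex_eq_iff)
  ultimately show ?thesis unfolding scale_def by (simp add: csqrt_of_real_nonneg)
qed

lemma W_periodic: "u \<in> \<Lambda> \<Longrightarrow> W (z + u) = W z"
  unfolding W_def by (simp only: wp_periodic)

lemma W_minus: "W (- z) = W z"
  unfolding W_def by (simp only: wp_minus)

lemma W_cnj: "W (cnj z) = cnj (W z)"
  using wp_half_period_real(3) unfolding W_def
  by (simp add: wp_cnj scale_real Reals_cnj_iff)

lemma W_meromorphic: "W meromorphic_on UNIV"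
  unfolding W_def by (intro meromorphic_intros wp_meromorphic)

lemma W_analytic: "z \<notin> \<Lambda> \<Longrightarrow> W analytic_on {z}"
  unfolding W_def by (intro analytic_intros wp_analytic_off_lattice scale_nonzero)

lemma W_tendsto: "z \<notin> \<Lambda> \<Longrightarrow> (W \<longlongrightarrow> W z) (at z)"
  using analytic_at_imp_isCont[OF W_analytic] by (simp add: isCont_def)

lemma W_translate:
  assumes "z \<notin> \<Lambda>" "z + \<omega> \<notin> \<Lambda>"
  shows "W z * W (z + \<omega>) = - 1"
proof -
  obtain K where K: "\<And>z. z \<notin> \<Lambda> \<Longrightarrow> z + \<omega> \<notin> \<Lambda> \<Longrightarrow> (\<wp> z - \<wp> \<omega>) * (\<wp> (z + \<omega>) - \<wp> \<omega>) = K"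
    using wp_translate_product by blast
  \<comment> \<open>The constant is evaluated at \<open>\<alpha> / 2\<close>, which \<omega> carries
    to \<open>\<beta> * \<i> / 2\<close> up to a period. This is the origin of the product under the
    root in \<sigma>.\<close>
  have eq: "complex_of_real \<alpha> / 2 + \<omega> = complex_of_real \<beta> * \<i> / 2 + complex_of_real \<alpha>"
    by (simp add: complex_eq_iff)
  have "K = (\<wp> (complex_of_real \<alpha> / 2) - \<wp> \<omega>) * (\<wp> (complex_of_real \<beta> * \<i> / 2) - \<wp> \<omega>)"
    using K[of "complex_of_real \<alpha> / 2"] half_periods(1,2)
    unfolding eq lattice_add_iff[OF lattice_generators(1)] wp_periodic[OF lattice_generators(1)] by simp
  then have "K = - \<sigma>\<^sup>2" by (simp add: scale_square algebra_simps)
  then show ?thesis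
    using K[OF assms] scale_nonzero unfolding W_def by (simp add: power2_eq_square)
qed

lemma W_at_lattice: "v \<in> \<Lambda> \<Longrightarrow> filterlim W at_infinity (at v)"
proof -
  assume v: "v \<in> \<Lambda>"
  have "filterlim (\<lambda>z. (- \<wp> \<omega>) + \<wp> z) at_infinity (at v)"
    by (rule tendsto_add_filterlim_at_infinity[OF tendsto_const wp_at_lattice[OF v]])
  then have "filterlim (\<lambda>z. inverse \<sigma> * ((- \<wp> \<omega>) + \<wp> z)) at_infinity (at v)"
    using scale_nonzero by (intro tendsto_mult_filterlim_at_infinity[OF tendsto_const]) auto
  then show ?thesis unfolding W_def by (simp add: field_simps)
qed

text \<open>The leading coefficient of the double pole of \<open>W\<close>; it determines which
  multiples of powers of \<open>W\<close> lower the order of a pole at 0.\<close>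

lemma W_at_0_scaled: "((\<lambda>x. x\<^sup>2 * W x) \<longlongrightarrow> 1 / \<sigma>) (at 0)"
proof -
  have "((\<lambda>x. \<wp> x - 1 / (x - 0)\<^sup>2) \<longlongrightarrow> \<wp> 0 - 1 / (0 - 0)\<^sup>2) (at 0)"
    using analytic_at_imp_isCont[OF wp_analytic_at_lattice[OF lattice_0]] by (simp add: isCont_def)
  then have "((\<lambda>x. \<wp> x - 1 / x\<^sup>2) \<longlongrightarrow> \<wp> 0) (at 0)" by simp
  then have "((\<lambda>x. (x\<^sup>2 * ((\<wp> x - 1 / x\<^sup>2) - \<wp> \<omega>) + 1) / \<sigma>) \<longlongrightarrow> (0\<^sup>2 * (\<wp> 0 - \<wp> \<omega>) + 1) / \<sigma>) (at 0)"
    using scale_nonzero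
    by (intro tendsto_divide tendsto_add tendsto_mult tendsto_power tendsto_const tendsto_ident_at
        tendsto_diff[OF _ tendsto_const])
  moreover have "\<forall>\<^sub>F x in at 0. (x\<^sup>2 * ((\<wp> x - 1 / x\<^sup>2) - \<wp> \<omega>) + 1) / \<sigma> = x\<^sup>2 * W x"
    by (auto simp: eventually_at_filter W_def right_diff_distrib)
  ultimately show ?thesis using Lim_transform_eventually by fastforce
qed

text \<open>Near its pole at 0, \<open>W\<close> avoids the finitely many roots of \<open>p\<close>;
  a meromorphic function on the plane that is not 0 near one point is nonzero near every point.
  Polynomial identities can therefore be read off from the values of \<open>W\<close> near a single
  point.\<close>

lemma eventually_poly_W_nonzero:
  assumes "p \<noteq> 0"
  shows "\<forall>\<^sub>F x in at z. poly p (W x) \<noteq> 0"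
proof -
  have ne: "\<forall>\<^sub>F x in at 0. poly p (W x) \<noteq> 0"
  proof -
    have "\<forall>\<^sub>F x in at 0. \<forall>r\<in>{r. poly p r = 0}. W x \<noteq> r"
      using poly_roots_finite[OF assms] W_at_lattice[OF lattice_0]
      by (intro eventually_ball_finite) (auto intro: filterlim_at_infinity_imp_eventually_ne)
    then show ?thesis by eventually_elim auto
  qed
  from meromorphic_imp_constant_or_avoid[OF meromorphic_on_poly[OF W_meromorphic], of p 0]
  consider "\<forall>\<^sub>F x in at 0. poly p (W x) = 0" | "\<forall>\<^sub>F x in at z. poly p (W x) \<noteq> 0"
    by (auto simp: eventually_cosparse_open_eq)
  then show ?thesis
  proof cases
    case 1
    with ne have "\<forall>\<^sub>F x in at (0::complex). False" by eventually_elim simp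
    then show ?thesis by (simp add: trivial_limit_def[symmetric])
  qed
qed

lemma tendsto_translate:
  assumes "\<And>z. f (z + u) = f z" "(f \<longlongrightarrow> l) (at z)"
  shows "(f \<longlongrightarrow> l) (at (z + u :: complex))"
  using LIM_offset[OF assms(2), of "- u"] assms(1)[of "x - u" for x] by simp

text \<open>Induction on a bound for half the pole order at 0. Subtracting the multiple of
  \<open>W ^ Suc n\<close> with the same leading term makes \<open>(x\<^sup>2) ^ Suc n * h x\<close>
  vanish at 0; as this product is even it vanishes doubly, and the bound on the order falls by 2.
  Without poles the function is constant.\<close>

lemma even_elliptic_polynomial:
  assumes "f meromorphic_on UNIV" "\<And>u z. u \<in> \<Lambda> \<Longrightarrow> f (z + u) = f z" "\<And>z. f (- z) = f z"
    and "\<And>z. z \<notin> \<Lambda> \<Longrightarrow> \<exists>l. (f \<longlongrightarrow> l) (at z)"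
    and "\<exists>l. ((\<lambda>x. (x\<^sup>2) ^ n * f x) \<longlongrightarrow> l) (at 0)"
  shows "\<exists>p. \<forall>z. \<forall>\<^sub>F x in at z. f x = poly p (W x)"
  using assms
proof (induction n arbitrary: f)
  case 0
  then obtain l where l: "(f \<longlongrightarrow> l) (at 0)" by auto
  have "\<exists>l. (f \<longlongrightarrow> l) (at z)" for z
  proof (cases "z \<in> \<Lambda>")
    case True
    then show ?thesis using tendsto_translate[OF 0(2) l, of z] by auto
  qed (rule 0(4))
  then obtain c where "\<And>z. \<forall>\<^sub>F x in at z. f x = c"
    using meromorphic_periodic_constant[OF 0(1,2)] by blast
  then show ?case by (intro exI[of _ "[:c:]"]) simp
next
  case (Suc n)
  obtain l where l: "((\<lambda>x. (x\<^sup>2) ^ Suc n * f x) \<longlongrightarrow> l) (at 0)" using Suc.prems(5) by blast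
  define a where "a = l * \<sigma> ^ Suc n"
  define h where "h = (\<lambda>x. f x - a * W x ^ Suc n)"
  have mero: "h meromorphic_on UNIV" unfolding h_def by (intro meromorphic_intros Suc.prems(1) W_meromorphic)
  have per: "h (z + u) = h z" if "u \<in> \<Lambda>" for u z
    unfolding h_def by (simp only: Suc.prems(2)[OF that] W_periodic[OF that])
  have even: "h (- z) = h z" for z unfolding h_def by (simp only: Suc.prems(3) W_minus)
  have lim: "\<exists>l. (h \<longlongrightarrow> l) (at z)" if z: "z \<notin> \<Lambda>" for z
  proof -
    obtain l where "(f \<longlongrightarrow> l) (at z)" using Suc.prems(4)[OF z] by blast
    then have "(h \<longlongrightarrow> l - a * W z ^ Suc n) (at z)"
      unfolding h_def by (intro tendsto_diff tendsto_mult tendsto_power tendsto_const W_tendsto z)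
    then show ?thesis by blast
  qed
  let ?F = "\<lambda>x. (x\<^sup>2) ^ Suc n * h x"
  have "((\<lambda>x. (x\<^sup>2) ^ Suc n * f x - a * (x\<^sup>2 * W x) ^ Suc n) \<longlongrightarrow> l - a * (1 / \<sigma>) ^ Suc n) (at 0)"
    by (intro tendsto_diff tendsto_mult tendsto_power tendsto_const W_at_0_scaled l)
  moreover have "l - a * (1 / \<sigma>) ^ Suc n = 0"
    unfolding a_def using scale_nonzero by (simp add: power_one_over)
  moreover have "(x\<^sup>2) ^ Suc n * f x - a * (x\<^sup>2 * W x) ^ Suc n = ?F x" for x
    unfolding h_def power_mult_distrib by (simp add: algebra_simps)
  ultimately have F0: "(?F \<longlongrightarrow> 0) (at 0)" by (simp only:)
  have "?F meromorphic_on {0}"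
    by (intro meromorphic_intros meromorphic_on_subset[OF mero]) auto
  moreover have "?F (2 * 0 - x) = ?F x" for x by (simp add: even)
  ultimately obtain l' where l': "((\<lambda>x. ?F x / (x - 0)\<^sup>2) \<longlongrightarrow> l') (at 0)"
    using tendsto_divide_square_by_vanishing_even[OF _ F0] by blast
  have "\<forall>\<^sub>F x in at 0. ?F x / (x - 0)\<^sup>2 = (x\<^sup>2) ^ n * h x"
    by (auto simp: eventually_at_filter)
  with l' have "((\<lambda>x. (x\<^sup>2) ^ n * h x) \<longlongrightarrow> l') (at 0)" by (rule Lim_transform_eventually)
  from Suc.IH[OF mero per even lim exI, OF _ _ this]
  obtain p where p: "\<And>z. \<forall>\<^sub>F x in at z. h x = poly p (W x)" by blast
  have "\<forall>\<^sub>F x in at z. f x = poly (p + monom a (Suc n)) (W x)" for z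
    using p[of z] by eventually_elim (simp add: h_def poly_monom algebra_simps)
  then show ?case by blast
qed

end

section \<open>Maps to the Riemann sphere\<close>

text \<open>Convergence in the Riemann sphere, phrased for complex-valued functions. Their values at
  isolated points may be junk, while the sphere-valued function is recovered from the
  limits.\<close>

definition tends_sphere :: "('a \<Rightarrow> complex) \<Rightarrow> 'a filter \<Rightarrow> riemann_sphere \<Rightarrow> bool" where
  "tends_sphere R F s =
     (case s of None \<Rightarrow> filterlim R at_infinity F | Some l \<Rightarrow> (R \<longlongrightarrow> l) F)"

lemma tends_sphere_unique:
  assumes "tends_sphere R F s" "tends_sphere R' F s'" "\<forall>\<^sub>F x in F. R x = R' x" "F \<noteq> bot"
  shows "s = s'"
proof -
  have "tends_sphere R F s'"
    using assms(2,3) by (auto simp: tends_sphere_def tendsto_cong filterlim_cong split: option.splits)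
  with assms(1,4) show ?thesis
    by (auto simp: tends_sphere_def split: option.splits
        dest: tendsto_unique[OF assms(4)] not_tendsto_and_filterlim_at_infinity[OF assms(4)])
qed

lemma tends_sphere_cnj:
  assumes "tends_sphere R F s" shows "tends_sphere (\<lambda>x. cnj (R x)) F (map_option cnj s)"
proof (cases s)
  case None
  then show ?thesis
    using assms by (auto simp: tends_sphere_def filterlim_at_infinity_conv_norm_at_top)
next
  case (Some l)
  then show ?thesis using assms by (auto simp: tends_sphere_def intro: tendsto_cnj)
qed

lemma tends_sphere_compose:
  "tends_sphere R F s \<Longrightarrow> filterlim g F G \<Longrightarrow> tends_sphere (\<lambda>x. R (g x)) G s"
  by (auto simp: tends_sphere_def split: option.splits intro: filterlim_compose)

lemma meromorphic_to_sphereI: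
  assumes R: "R meromorphic_on UNIV" and lim: "\<And>z. tends_sphere R (at z) (f z)"
  shows "meromorphic_to_sphere f"
  unfolding meromorphic_to_sphere_def
proof (intro exI conjI ext)
  show "remove_sings R nicely_meromorphic_on UNIV"
    by (rule remove_sings_nicely_meromorphic[OF R])
  fix z
  have "isolated_singularity_at R z" using R by (auto simp: meromorphic_on_altdef)
  then have ev: "\<forall>\<^sub>F x in at z. remove_sings R x = R x" by (rule eventually_remove_sings_eq_at)
  show "f z = (if is_pole (remove_sings R) z then None else Some (remove_sings R z))"
  proof (cases "f z")
    case None
    then have "is_pole R z" using lim[of z] by (simp add: tends_sphere_def is_pole_def)
    then have "is_pole (remove_sings R) z"
      using is_pole_cong[OF ev refl] by simp
    with None show ?thesis by simp
  next
    case (Some l)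
    then have l: "(R \<longlongrightarrow> l) (at z)" using lim[of z] by (simp add: tends_sphere_def)
    then have "\<not> is_pole R z"
      using not_tendsto_and_filterlim_at_infinity[OF _ l] by (auto simp: is_pole_def)
    then have "\<not> is_pole (remove_sings R) z"
      using is_pole_cong[OF ev refl] by simp
    moreover have "remove_sings R z = l" using l by (rule remove_sings_eqI)
    ultimately show ?thesis using Some by simp
  qed
qed

text \<open>The third property fixes the values at the poles as well, so symmetries of
  \<open>f\<close> pass to \<open>R\<close> pointwise, without limits.\<close>

lemma meromorphic_to_sphereE:
  assumes "meromorphic_to_sphere f"
  obtains R where "R meromorphic_on UNIV" "\<And>z. tends_sphere R (at z) (f z)"
    "\<And>z. R z = (case f z of None \<Rightarrow> 0 | Some l \<Rightarrow> l)"
proof -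
  obtain g where g: "g nicely_meromorphic_on UNIV"
    "f = (\<lambda>z. if is_pole g z then None else Some (g z))"
    using assms unfolding meromorphic_to_sphere_def by blast
  have 1: "(is_pole g z \<and> g z = 0) \<or> (g \<longlongrightarrow> g z) (at z)" for z
    using g(1) unfolding nicely_meromorphic_on_def by blast
  show thesis
  proof (rule that)
    show "g meromorphic_on UNIV" using g(1) unfolding nicely_meromorphic_on_def by blast
    show "tends_sphere g (at z) (f z)" for z
      using 1[of z] by (auto simp: g(2) tends_sphere_def is_pole_def)
    show "g z = (case f z of None \<Rightarrow> 0 | Some l \<Rightarrow> l)" for z
      using 1[of z] not_tendsto_and_filterlim_at_infinity[of "at z" g "g z"]
      by (auto simp: g(2) is_pole_def)
  qed
qed

text \<open>After the division every power of \<open>w\<close> below \<open>k\<close> becomes a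
  positive power of \<open>1 / w\<close>, which tends to 0; only the coefficient of degree
  \<open>k\<close> survives.\<close>

lemma poly_divide_power_tendsto:
  fixes w :: "'a \<Rightarrow> complex"
  assumes w: "filterlim w at_infinity F" and k: "degree n \<le> k"
  shows "((\<lambda>x. poly n (w x) / w x ^ k) \<longlongrightarrow> coeff n k) F"
proof -
  have poly_n: "poly n y = (\<Sum>i\<le>k. coeff n i * y ^ i)" for y
    unfolding poly_altdef using k by (intro sum.mono_neutral_left) (auto simp: coeff_eq_0)
  have "((\<lambda>x. inverse (w x)) \<longlongrightarrow> 0) F"
    by (rule filterlim_compose[OF tendsto_inverse_0 w])
  then have "((\<lambda>x. \<Sum>i\<le>k. coeff n i * inverse (w x) ^ (k - i)) \<longlongrightarrow> (\<Sum>i\<le>k. coeff n i * 0 ^ (k - i))) F"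
    by (intro tendsto_sum tendsto_mult tendsto_const tendsto_power)
  also have "(\<Sum>i\<le>k. coeff n i * 0 ^ (k - i)) = (\<Sum>i\<le>k. if i = k then coeff n k else 0)"
    by (intro sum.cong) auto
  also have "\<dots> = coeff n k" by simp
  finally show ?thesis
  proof (rule Lim_transform_eventually)
    have "\<forall>\<^sub>F x in F. w x \<noteq> 0" using w by (rule filterlim_at_infinity_imp_eventually_ne)
    then show "\<forall>\<^sub>F x in F. (\<Sum>i\<le>k. coeff n i * inverse (w x) ^ (k - i)) = poly n (w x) / w x ^ k"
    proof eventually_elim
      case (elim x)
      have "inverse (w x) ^ (k - i) = w x ^ i / w x ^ k" if "i \<le> k" for i
        using that elim by (simp add: power_diff field_simps)
      then show ?case unfolding poly_n sum_divide_distrib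
        by (intro sum.cong) auto
    qed
  qed
qed

text \<open>At a zero of \<open>d\<close>, coprimality keeps \<open>n\<close> away from 0, so the
  quotient tends to infinity; at infinity the degrees decide. The assumption \<open>ne\<close>
  guarantees that what is inverted is eventually nonzero.\<close>

lemma tends_sphere_rational_map:
  fixes w :: "'a \<Rightarrow> complex"
  assumes Q: "quot_of_fract Q = (n, d)" and w: "tends_sphere w F s"
    and ne: "\<And>p. p \<noteq> 0 \<Longrightarrow> \<forall>\<^sub>F x in F. poly p (w x) \<noteq> 0"
  shows "tends_sphere (\<lambda>x. poly n (w x) / poly d (w x)) F (rational_map Q s)"
proof (cases s)
  case None
  then have w: "filterlim w at_infinity F" using w by (simp add: tends_sphere_def)
  have d0: "d \<noteq> 0" using snd_quot_of_fract_nonzero[of Q] by (simp add: Q)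
  have w0: "\<forall>\<^sub>F x in F. w x \<noteq> 0" using w by (rule filterlim_at_infinity_imp_eventually_ne)
  have quot: "((\<lambda>x. poly p (w x) / poly q (w x)) \<longlongrightarrow> coeff p (degree q) / lead_coeff q) F"
    if "degree p \<le> degree q" "q \<noteq> 0" for p q
  proof -
    have "((\<lambda>x. (poly p (w x) / w x ^ degree q) / (poly q (w x) / w x ^ degree q)) \<longlongrightarrow>
        coeff p (degree q) / lead_coeff q) F"
      using that by (intro tendsto_divide poly_divide_power_tendsto[OF w]) auto
    then show ?thesis
    proof (rule Lim_transform_eventually)
      show "\<forall>\<^sub>F x in F. (poly p (w x) / w x ^ degree q) / (poly q (w x) / w x ^ degree q) =
          poly p (w x) / poly q (w x)"
        using w0 by eventually_elim simp
    qed
  qed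
  show ?thesis
  proof (cases "degree n > degree d")
    case True
    then have n0: "n \<noteq> 0" by auto
    have "((\<lambda>x. poly d (w x) / poly n (w x)) \<longlongrightarrow> 0) F"
      using quot[of d n] True n0 by (simp add: coeff_eq_0)
    then have "filterlim (\<lambda>x. poly d (w x) / poly n (w x)) (at 0) F"
    proof (rule filterlim_atI)
      show "\<forall>\<^sub>F x in F. poly d (w x) / poly n (w x) \<noteq> 0"
        using ne[OF d0] ne[OF n0] by eventually_elim simp
    qed
    from filterlim_compose[OF filterlim_inverse_at_infinity this]
    show ?thesis using True by (simp add: tends_sphere_def rational_map_def Q None)
  next
    case False
    then show ?thesis using quot[of n d] d0 by (simp add: tends_sphere_def rational_map_def Q None)
  qed
next
  case (Some l)
  then have w: "(w \<longlongrightarrow> l) F" using w by (simp add: tends_sphere_def)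
  have d0: "d \<noteq> 0" using snd_quot_of_fract_nonzero[of Q] by (simp add: Q)
  show ?thesis
  proof (cases "poly d l = 0")
    case False
    then show ?thesis
      by (auto simp: tends_sphere_def rational_map_def Q Some intro!: tendsto_intros w)
  next
    case True
    have "coprime n d" using coprime_quot_of_fract[of Q] by (simp add: Q)
    with True have "poly n l \<noteq> 0" using coprime_poly_0 by blast
    moreover have "filterlim (\<lambda>x. poly d (w x)) (at 0) F"
      using tendsto_poly[OF w, of d] ne[OF d0] True by (intro filterlim_atI) auto
    ultimately have "filterlim (\<lambda>x. poly n (w x) * inverse (poly d (w x))) at_infinity F"
      by (intro tendsto_mult_filterlim_at_infinity[OF tendsto_poly[OF w]]
          filterlim_compose[OF filterlim_inverse_at_infinity])
    then show ?thesis using True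
      by (simp add: tends_sphere_def rational_map_def Q Some divide_inverse)
  qed
qed

section \<open>Even elliptic functions as rational functions of \<open>W\<close>\<close>

context rectangular_lattice
begin

lemma even_elliptic_rational:
  assumes f: "f meromorphic_on UNIV" and per: "\<And>u z. u \<in> \<Lambda> \<Longrightarrow> f (z + u) = f z"
    and even: "\<And>z. f (- z) = f z"
  obtains n d where "d \<noteq> 0" "\<And>z. \<forall>\<^sub>F x in at z. f x = poly n (W x) / poly d (W x)"
proof -
  \<comment> \<open>The disc meets every class modulo \<Lambda>. Lattice points are left out because
    \<open>W\<close> has poles there, so that factors \<open>W x - W p\<close> cannot remove a pole
    of \<open>f\<close>; they are left to \<open>even_elliptic_polynomial\<close>.\<close>
  define P where "P = cball 0 (\<alpha> + \<beta>) \<inter> {z. \<not> f analytic_on {z}} - \<Lambda>"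
  have "finite (cball 0 (\<alpha> + \<beta>) \<inter> {z. \<not> f analytic_on {z}})"
    using meromorphic_on_imp_sparse_singularities[OF f]
    by (intro finite_not_islimpt_in_compact) (auto simp: sparse_in_open)
  then have fin: "finite P" unfolding P_def by blast
  have "\<forall>p. \<exists>N l. ((\<lambda>x. (x - p) ^ N * f x) \<longlongrightarrow> l) (at p)"
    using meromorphic_order_finite[OF meromorphic_on_subset[OF f subset_UNIV]] by metis
  then obtain N :: "complex \<Rightarrow> nat"
    where N: "\<And>p. \<exists>l. ((\<lambda>x. (x - p) ^ N p * f x) \<longlongrightarrow> l) (at p)" by metis
  \<comment> \<open>\<open>W x - W p\<close> vanishes at \<open>p\<close>, so its power
    \<open>N p\<close> compensates the pole of \<open>f\<close> there.\<close>
  define d where "d = (\<Prod>p\<in>P. [:- W p, 1:] ^ N p)"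
  have d0: "d \<noteq> 0" using fin by (auto simp: d_def)
  have pd: "poly d y = (\<Prod>p\<in>P. (y - W p) ^ N p)" for y
    unfolding d_def by (simp add: poly_prod poly_power)
  define g where "g = (\<lambda>x. f x * poly d (W x))"
  have g_per: "g (z + u) = g z" if "u \<in> \<Lambda>" for u z
    unfolding g_def by (simp only: per[OF that] W_periodic[OF that])
  have g_even: "g (- z) = g z" for z unfolding g_def by (simp only: even W_minus)
  have g_mero: "g meromorphic_on UNIV"
    unfolding g_def by (intro meromorphic_intros f meromorphic_on_poly W_meromorphic)
  have bounded: "\<exists>l. (g \<longlongrightarrow> l) (at q)" if q: "q \<notin> \<Lambda>" "norm q \<le> \<alpha> + \<beta>" for q
  proof (cases "f analytic_on {q}")
    case True
    then have "(f \<longlongrightarrow> f q) (at q)" using analytic_at_imp_isCont by (auto simp: isCont_def)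
    then have "(g \<longlongrightarrow> f q * poly d (W q)) (at q)"
      unfolding g_def by (intro tendsto_mult tendsto_poly W_tendsto q)
    then show ?thesis by blast
  next
    case False
    then have qP: "q \<in> P" using q by (simp add: P_def)
    obtain l where l: "((\<lambda>x. (x - q) ^ N q * f x) \<longlongrightarrow> l) (at q)" using N by blast
    have "((\<lambda>x. W x - W q) \<longlongrightarrow> W q - W q) (at q)"
      by (intro tendsto_diff tendsto_const W_tendsto q)
    moreover have "(\<lambda>x. W x - W q) meromorphic_on {q}"
      by (intro meromorphic_intros meromorphic_on_subset[OF W_meromorphic]) auto
    ultimately obtain D where D: "((\<lambda>x. (W x - W q) / (x - q)) \<longlongrightarrow> D) (at q)"
      using tendsto_divide_by_vanishing[of "\<lambda>x. W x - W q" q] by auto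
    have "((\<lambda>x. ((x - q) ^ N q * f x) * ((W x - W q) / (x - q)) ^ N q * (\<Prod>p\<in>P - {q}. (W x - W p) ^ N p)) \<longlongrightarrow>
        l * D ^ N q * (\<Prod>p\<in>P - {q}. (W q - W p) ^ N p)) (at q)"
      by (intro tendsto_mult tendsto_power tendsto_prod tendsto_diff tendsto_const W_tendsto q l D)
    moreover have "\<forall>\<^sub>F x in at q. ((x - q) ^ N q * f x) * ((W x - W q) / (x - q)) ^ N q *
        (\<Prod>p\<in>P - {q}. (W x - W p) ^ N p) = g x"
      unfolding eventually_at_filter
      by (rule always_eventually) (simp add: g_def pd prod.remove[OF fin qP] power_divide)
    ultimately show ?thesis using Lim_transform_eventually by blast
  qed
  have lim: "\<exists>l. (g \<longlongrightarrow> l) (at z)" if z: "z \<notin> \<Lambda>" for z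
  proof -
    obtain u where u: "u \<in> \<Lambda>" "norm (z - u) \<le> \<alpha> + \<beta>" by (rule lattice_reduce)
    have "z - u \<notin> \<Lambda>" using z lattice_add[OF _ u(1), of "z - u"] by auto
    then obtain l where "(g \<longlongrightarrow> l) (at (z - u))" using bounded u by blast
    from tendsto_translate[OF g_per[OF u(1)] this] show ?thesis by auto
  qed
  obtain m l where l: "((\<lambda>x. (x - 0) ^ m * g x) \<longlongrightarrow> l) (at 0)"
    using meromorphic_order_finite[OF meromorphic_on_subset[OF g_mero subset_UNIV]] by blast
  \<comment> \<open>A further factor \<open>x ^ m\<close> makes the exponent even, as
    \<open>even_elliptic_polynomial\<close> measures the order at 0 in powers of
    \<open>x\<^sup>2\<close>.\<close>
  have "((\<lambda>x. x ^ m * ((x - 0) ^ m * g x)) \<longlongrightarrow> 0 ^ m * l) (at 0)"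
    by (intro tendsto_mult tendsto_power tendsto_ident_at l)
  moreover have "x ^ m * ((x - 0) ^ m * g x) = (x\<^sup>2) ^ m * g x" for x
    by (simp add: power2_eq_square power_mult_distrib)
  ultimately have "((\<lambda>x. (x\<^sup>2) ^ m * g x) \<longlongrightarrow> 0 ^ m * l) (at 0)" by (simp only:)
  from even_elliptic_polynomial[OF g_mero g_per g_even lim exI, OF _ _ this]
  obtain n where n: "\<And>z. \<forall>\<^sub>F x in at z. g x = poly n (W x)" by blast
  show thesis
  proof (rule that[OF d0])
    show "\<forall>\<^sub>F x in at z. f x = poly n (W x) / poly d (W x)" for z
      using n[of z] eventually_poly_W_nonzero[OF d0, of z]
      by eventually_elim (simp add: g_def field_simps)
  qed
qed

definition W_sphere :: "complex \<Rightarrow> riemann_sphere" where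
  "W_sphere z = map_option (\<lambda>w. (w - \<wp> \<omega>) / \<sigma>) (weierstrass_sphere \<Lambda> z)"

lemma tends_sphere_W: "tends_sphere W (at z) (W_sphere z)"
  using W_at_lattice[of z] W_tendsto[of z]
  by (simp add: tends_sphere_def W_sphere_def weierstrass_sphere_def W_def)

lemma tends_sphere_rational_W:
  assumes "quot_of_fract Q = (n, d)"
  shows "tends_sphere (\<lambda>x. poly n (W x) / poly d (W x)) (at z) (rational_map Q (W_sphere z))"
  using assms tends_sphere_W eventually_poly_W_nonzero by (rule tends_sphere_rational_map)

end

section \<open>Rational functions commuting with the antipodal map\<close>

text \<open>As \<open>1 / 0 = 0\<close>, the point 0 is fixed instead of being sent to infinity. The
  function is thus an involution of the plane, but agrees with the antipodal map of the sphere only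
  for nonzero \<open>w\<close>.\<close>

definition antipode :: "complex \<Rightarrow> complex" where "antipode w = - 1 / cnj w"

lemma antipode_antipode [simp]: "antipode (antipode w) = w"
  by (simp add: antipode_def)

text \<open>A fixed point would satisfy \<open>w * cnj w = - 1\<close>. Hence a nonzero root and its
  antipode always give two distinct linear factors.\<close>

lemma antipode_neq: "w \<noteq> 0 \<Longrightarrow> antipode w \<noteq> w"
proof
  assume "w \<noteq> 0" "antipode w = w"
  then have "w * cnj w = - 1" by (simp add: antipode_def field_simps)
  then have "complex_of_real ((norm w)\<^sup>2) = of_real (- 1)" by (simp only: complex_norm_square) simp
  then have "(norm w)\<^sup>2 = - 1" by (simp only: of_real_eq_iff)
  then show False by (metis not_one_le_zero zero_le_power2 neg_0_le_iff_le)
qed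

lemma eventually_cofinite_antipode:
  assumes "\<forall>\<^sub>F w in cofinite. P w" shows "\<forall>\<^sub>F w in cofinite. P (antipode w)"
proof -
  have "inj antipode" by (metis antipode_antipode injI)
  then have "finite (antipode -` {w. \<not> P w})"
    using assms by (intro finite_vimageI) (simp_all add: eventually_cofinite)
  then show ?thesis by (simp add: eventually_cofinite vimage_def)
qed

lemma eventually_cofinite_neq: "\<forall>\<^sub>F w in cofinite. w \<noteq> a"
  by (simp add: eventually_cofinite)

lemma eventually_cofinite_poly:
  "p \<noteq> 0 \<Longrightarrow> \<forall>\<^sub>F w::complex in cofinite. poly p w \<noteq> 0"
  by (simp add: eventually_cofinite poly_roots_finite)

lemma cofinite_imp_eventually_at:
  assumes "\<forall>\<^sub>F w in cofinite. P w" shows "\<forall>\<^sub>F w in at (a :: complex). P w"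
proof -
  have "finite ({w. \<not> P w} - {a})" using assms by (simp add: eventually_cofinite)
  then have "open (- ({w. \<not> P w} - {a}))" "a \<in> - ({w. \<not> P w} - {a})"
    by (intro open_Compl finite_imp_closed) auto
  from eventually_at_in_open[OF this] show ?thesis
    by (rule eventually_mono) auto
qed

text \<open>
  For \<open>k = 0\<close> this says that the rational function \<open>n / d\<close> intertwines the antipodal map with
  complex conjugation. Each of the factors \<open>w\<close> and \<open>(w - a) (cnj a w + 1)\<close> raises the
  weight \<open>k\<close> by 1.
\<close>

definition antipodal :: "int \<Rightarrow> complex poly \<Rightarrow> complex poly \<Rightarrow> bool" where
  "antipodal k n d \<longleftrightarrow> (\<forall>\<^sub>F w in cofinite.
     poly n w * cnj (poly d (antipode w)) = (- (w\<^sup>2)) powi k * (cnj (poly n (antipode w)) * poly d w))"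

lemma antipodal_swap:
  assumes "antipodal k n d" shows "antipodal (- k) d n"
  unfolding antipodal_def
  using assms[unfolded antipodal_def] eventually_cofinite_neq[of 0]
proof eventually_elim
  case (elim w)
  then have "(- (w\<^sup>2)) powi (- k) * (cnj (poly d (antipode w)) * poly n w) =
      ((- (w\<^sup>2)) powi (- k) * (- (w\<^sup>2)) powi k) * (cnj (poly n (antipode w)) * poly d w)"
    by (simp add: mult_ac)
  also have "(- (w\<^sup>2)) powi (- k) * (- (w\<^sup>2)) powi k = 1"
    using elim by (simp add: power_int_minus)
  finally show ?case by (simp add: mult_ac)
qed

lemma antipodal_mult:
  assumes "antipodal k n d" "antipodal k' n' d'" shows "antipodal (k + k') (n * n') (d * d')"
  unfolding antipodal_def
  using assms[unfolded antipodal_def] eventually_cofinite_neq[of 0]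
proof eventually_elim
  case (elim w)
  have "poly (n * n') w * cnj (poly (d * d') (antipode w)) =
      (poly n w * cnj (poly d (antipode w))) * (poly n' w * cnj (poly d' (antipode w)))"
    by (simp add: mult_ac)
  also have "\<dots> = ((- (w\<^sup>2)) powi k * (- (w\<^sup>2)) powi k') *
      (cnj (poly (n * n') (antipode w)) * poly (d * d') w)"
    unfolding elim by (simp add: mult_ac)
  also have "(- (w\<^sup>2)) powi k * (- (w\<^sup>2)) powi k' = (- (w\<^sup>2)) powi (k + k')"
    using elim by (simp add: power_int_add)
  finally show ?case .
qed

text \<open>The identity for \<open>n\<close> and \<open>d\<close> can be divided out wherever
  \<open>poly n w\<close> and \<open>poly d (antipode w)\<close> are nonzero, which excludes only
  finitely many \<open>w\<close>.\<close>

lemma antipodal_cancel: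
  assumes "antipodal (k + k') (n * n') (d * d')" "antipodal k n d" "n \<noteq> 0" "d \<noteq> 0"
  shows "antipodal k' n' d'"
  unfolding antipodal_def
  using assms(1,2)[unfolded antipodal_def] eventually_cofinite_neq[of 0]
    eventually_cofinite_poly[OF \<open>n \<noteq> 0\<close>] eventually_cofinite_antipode[OF eventually_cofinite_poly[OF \<open>d \<noteq> 0\<close>]]
proof eventually_elim
  case (elim w)
  have "(poly n w * cnj (poly d (antipode w))) * (poly n' w * cnj (poly d' (antipode w))) =
      (- (w\<^sup>2)) powi (k + k') * (cnj (poly (n * n') (antipode w)) * poly (d * d') w)"
    using elim(1) by (simp add: mult_ac)
  also have "\<dots> = ((- (w\<^sup>2)) powi k * (cnj (poly n (antipode w)) * poly d w)) *
      ((- (w\<^sup>2)) powi k' * (cnj (poly n' (antipode w)) * poly d' w))"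
    using elim(3) by (simp add: power_int_add mult_ac)
  also have "(- (w\<^sup>2)) powi k * (cnj (poly n (antipode w)) * poly d w) = poly n w * cnj (poly d (antipode w))"
    using elim(2) by simp
  finally show ?case using elim(4,5) by simp
qed

lemma antipodal_same: "antipodal 0 p p"
  unfolding antipodal_def by (simp add: mult.commute)

lemma antipodal_X: "antipodal 1 [:0, 1:] 1"
  unfolding antipodal_def using eventually_cofinite_neq[of 0]
  by eventually_elim (simp add: antipode_def field_simps power2_eq_square)

lemma antipodal_factor_poly: "antipodal 1 ([:- a, 1:] * [:1, cnj a:]) 1"
  unfolding antipodal_def using eventually_cofinite_neq[of 0]
  by eventually_elim (simp add: antipode_def field_simps power2_eq_square)

lemma antipodal_const: "antipodal 0 [:complex_of_real C:] 1"
  unfolding antipodal_def by simp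

text \<open>The identity holds on a punctured neighbourhood of \<open>a\<close> and passes to the
  limit. The left side tends to 0, while on the right the power of \<open>- (a\<^sup>2)\<close> and
  \<open>poly d a\<close> are nonzero.\<close>

lemma antipodal_root:
  assumes anti: "antipodal k n d" and a: "poly n a = 0" "a \<noteq> 0" and d: "poly d a \<noteq> 0"
  shows "poly n (antipode a) = 0"
proof -
  let ?l = "\<lambda>w. poly n w * cnj (poly d (antipode w))"
  let ?r = "\<lambda>w. (- (w\<^sup>2)) powi k * (cnj (poly n (antipode w)) * poly d w)"
  have "(antipode \<longlongrightarrow> antipode a) (at a)"
    unfolding antipode_def using a by (intro tendsto_intros) auto
  then have lim: "(?l \<longlongrightarrow> poly n a * cnj (poly d (antipode a))) (at a)"
    "(?r \<longlongrightarrow> (- (a\<^sup>2)) powi k * (cnj (poly n (antipode a)) * poly d a)) (at a)"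
    using a by (intro tendsto_mult tendsto_cnj tendsto_poly tendsto_ident_at tendsto_power_int
        tendsto_minus tendsto_power; simp)+
  have "\<forall>\<^sub>F w in at a. ?l w = ?r w"
    using anti unfolding antipodal_def by (rule cofinite_imp_eventually_at)
  from tendsto_unique[OF trivial_limit_at Lim_transform_eventually[OF lim(1) this] lim(2)] a d show ?thesis by simp
qed

text \<open>Multiplicities are expressed by repetition in the lists and the weight \<open>k\<close>
  is left free, because the induction splits off one factor at a time and passes through nonzero
  weights.\<close>

definition antipodal_form :: "int \<Rightarrow> complex poly fract \<Rightarrow> bool" where
  "antipodal_form k Q \<longleftrightarrow> (\<exists>(C::real) (p::int) as bs. 0 \<notin> set as \<union> set bs \<and>
     Q = to_fract [:complex_of_real C:] * to_fract [:0, 1:] powi p *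
       (prod_list (map antipodal_factor as) / prod_list (map antipodal_factor bs)) \<and>
     k = p + int (length as) - int (length bs))"

lemma antipodal_formE:
  assumes "antipodal_form k Q"
  obtains C p as bs where "0 \<notin> set as \<union> set bs"
     "Q = to_fract [:complex_of_real C:] * to_fract [:0, 1:] powi p *
       (prod_list (map antipodal_factor as) / prod_list (map antipodal_factor bs))"
     "k = p + int (length as) - int (length bs)"
  using assms unfolding antipodal_form_def by blast

lemma to_fract_X_nonzero: "to_fract [:0, 1:] \<noteq> (0 :: complex poly fract)"
  by simp

lemma antipodal_form_mult_X:
  assumes "antipodal_form k Q" shows "antipodal_form (k + 1) (to_fract [:0, 1:] * Q)"
proof -
  obtain C p as bs where *: "0 \<notin> set as \<union> set bs"
     "Q = to_fract [:complex_of_real C:] * to_fract [:0, 1:] powi p *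
       (prod_list (map antipodal_factor as) / prod_list (map antipodal_factor bs))"
     "k = p + int (length as) - int (length bs)"
    using assms by (rule antipodal_formE)
  have "to_fract [:0, 1:] powi (p + 1) = to_fract [:0, 1:] powi p * (to_fract [:0, 1:] :: complex poly fract)"
    by (rule power_int_add_1[OF disjI1[OF to_fract_X_nonzero]])
  then show ?thesis unfolding antipodal_form_def
    by (intro exI[of _ C] exI[of _ "p + 1"] exI[of _ as] exI[of _ bs])
       (use * in \<open>simp add: mult_ac\<close>)
qed

lemma antipodal_form_mult_factor:
  assumes "antipodal_form k Q" "a \<noteq> 0" shows "antipodal_form (k + 1) (antipodal_factor a * Q)"
proof -
  obtain C p as bs where *: "0 \<notin> set as \<union> set bs"
     "Q = to_fract [:complex_of_real C:] * to_fract [:0, 1:] powi p *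
       (prod_list (map antipodal_factor as) / prod_list (map antipodal_factor bs))"
     "k = p + int (length as) - int (length bs)"
    using assms(1) by (rule antipodal_formE)
  show ?thesis unfolding antipodal_form_def
    by (intro exI[of _ C] exI[of _ p] exI[of _ "a # as"] exI[of _ bs])
       (use * assms(2) in \<open>simp add: mult_ac\<close>)
qed

lemma antipodal_form_inverse:
  assumes "antipodal_form k Q" shows "antipodal_form (- k) (inverse Q)"
proof -
  obtain C p as bs where *: "0 \<notin> set as \<union> set bs"
     "Q = to_fract [:complex_of_real C:] * to_fract [:0, 1:] powi p *
       (prod_list (map antipodal_factor as) / prod_list (map antipodal_factor bs))"
     "k = p + int (length as) - int (length bs)"
    using assms by (rule antipodal_formE)
  have C: "inverse (to_fract [:complex_of_real C:]) = to_fract [:complex_of_real (inverse C):]"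
  proof (cases "C = 0")
    case False
    then have "to_fract [:complex_of_real C:] * to_fract [:complex_of_real (inverse C):] = 1"
      by (simp flip: to_fract_mult add: one_pCons[symmetric])
    then show ?thesis by (rule inverse_unique)
  qed simp
  have "inverse Q = to_fract [:complex_of_real (inverse C):] * to_fract [:0, 1:] powi (- p) *
      (prod_list (map antipodal_factor bs) / prod_list (map antipodal_factor as))"
    unfolding *(2) C[symmetric] divide_inverse inverse_mult_distrib inverse_inverse_eq power_int_minus
    by (simp only: mult_ac)
  moreover have "0 \<notin> set bs \<union> set as" "- k = - p + int (length bs) - int (length as)"
    using *(1,3) by auto
  ultimately show ?thesis unfolding antipodal_form_def by blast
qed

text \<open>Absolute values at a real \<open>t > 1\<close>, where \<open>t\<^sup>2\<close> differs
  from 1, force \<open>k = 0\<close>; the remaining identity says that \<open>a / b\<close> equals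
  its conjugate.\<close>

lemma antipodal_constants:
  assumes anti: "antipodal k [:a:] [:b:]" and nz: "a \<noteq> 0" "b \<noteq> 0"
  shows "k = 0" "a / b \<in> \<real>"
proof -
  have "finite {w. \<not> a * cnj b = (- (w\<^sup>2)) powi k * (cnj a * b)}"
    using anti by (simp add: antipodal_def eventually_cofinite)
  moreover have "infinite (complex_of_real ` {1<..})"
    by (subst finite_image_iff) (auto simp: inj_on_def infinite_Ioi)
  ultimately obtain t where "t > 1" and eq: "a * cnj b = (- ((complex_of_real t)\<^sup>2)) powi k * (cnj a * b)"
    using finite_subset[of "complex_of_real ` {1<..}" "{w. \<not> a * cnj b = (- (w\<^sup>2)) powi k * (cnj a * b)}"] by blast
  from arg_cong[OF eq, of norm] have "(t\<^sup>2) powi k = 1"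
    using nz by (simp add: norm_mult norm_power_int norm_power)
  moreover have "t\<^sup>2 > 1" using \<open>t > 1\<close> by simp
  moreover have "(t\<^sup>2) ^ nat \<bar>k\<bar> = 1"
    using calculation(1) by (cases "k \<ge> 0") (auto simp: power_int_def power_inverse)
  ultimately show "k = 0"
    using one_less_power[of "t\<^sup>2" "nat \<bar>k\<bar>"] by (cases "k = 0") auto
  with eq nz have "cnj (a / b) = a / b" by (simp add: field_simps)
  then show "a / b \<in> \<real>" by (simp add: Reals_cnj_iff)
qed

text \<open>Induction on the total degree. A root 0 of the numerator splits off \<open>w\<close>, a
  common root is cancelled, and any other root is split off together with its antipode. If only the
  denominator has roots, \<open>n\<close> and \<open>d\<close> are exchanged, which negates the
  weight.\<close>

lemma antipodal_imp_form:
  assumes "antipodal k n d" "n \<noteq> 0" "d \<noteq> 0"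
  shows "antipodal_form k (to_fract n / to_fract d)"
  using assms
proof (induction "degree n + degree d" arbitrary: k n d rule: less_induct)
  case less
  have step: "antipodal_form k (to_fract n / to_fract d)"
    if anti: "antipodal k n d" and nz: "n \<noteq> 0" "d \<noteq> 0" and deg: "degree n > 0"
      and IH: "\<And>k' n' d'. degree n' + degree d' < degree n + degree d \<Longrightarrow> antipodal k' n' d' \<Longrightarrow>
        n' \<noteq> 0 \<Longrightarrow> d' \<noteq> 0 \<Longrightarrow> antipodal_form k' (to_fract n' / to_fract d')" for k n d
  proof -
    have cancel: "antipodal_form (k - 1) (to_fract n' / to_fract d)"
      if "n = q * n'" "antipodal 1 q 1" "degree q > 0" for q n'
    proof (rule IH)
      have nz': "q \<noteq> 0" "n' \<noteq> 0" using nz that by auto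
      then show "degree n' + degree d < degree n + degree d" "n' \<noteq> 0" "d \<noteq> 0"
        using that nz by (simp_all add: degree_mult_eq)
      have "antipodal (1 + (k - 1)) (q * n') (1 * d)" using anti that by simp
      from antipodal_cancel[OF this that(2) nz'(1)] show "antipodal (k - 1) n' d" by simp
    qed
    obtain a where a: "poly n a = 0"
      using fundamental_theorem_of_algebra[of n] deg by (auto simp: constant_degree)
    then obtain n1 where n1: "n = [:- a, 1:] * n1" by (auto simp: poly_eq_0_iff_dvd)
    consider "a = 0" | "a \<noteq> 0" "poly d a = 0" | "a \<noteq> 0" "poly d a \<noteq> 0" by blast
    then show ?thesis
    proof cases
      case 1
      then have n: "n = [:0, 1:] * n1" using n1 by simp
      from antipodal_form_mult_X[OF cancel[OF n antipodal_X]]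
      have "antipodal_form k (to_fract [:0, 1:] * (to_fract n1 / to_fract d))" by simp
      then show ?thesis unfolding n to_fract_mult times_divide_eq_right .
    next
      case 2
      then obtain d1 where d1: "d = [:- a, 1:] * d1" by (auto simp: poly_eq_0_iff_dvd)
      have nz': "n1 \<noteq> 0" "d1 \<noteq> 0" using nz n1 d1 by auto
      have "antipodal (0 + k) ([:- a, 1:] * n1) ([:- a, 1:] * d1)" using anti n1 d1 by simp
      from antipodal_cancel[OF this antipodal_same] have "antipodal k n1 d1" by simp
      moreover have "degree n1 + degree d1 < degree n + degree d"
        unfolding n1 d1 using nz' by (subst (1 2) degree_mult_eq) auto
      ultimately have "antipodal_form k (to_fract n1 / to_fract d1)" using nz' by (intro IH)
      moreover have "to_fract n / to_fract d = to_fract n1 / to_fract d1"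
        unfolding n1 d1 to_fract_mult by (rule mult_divide_mult_cancel_left) simp
      ultimately show ?thesis by simp
    next
      case 3
      have "poly n (antipode a) = 0" using antipodal_root[OF anti a] 3 by blast
      then have "poly n1 (antipode a) = 0" using antipode_neq[OF 3(1)] by (simp add: n1)
      then obtain n2 where n2: "n1 = [:- antipode a, 1:] * n2" by (auto simp: poly_eq_0_iff_dvd)
      define q where "q = [:- a, 1:] * [:1, cnj a:]"
      \<comment> \<open>The second factor of \<open>q\<close> is the linear factor of the antipode
        up to the scalar \<open>cnj a\<close>, which is compensated in the quotient.\<close>
      have eq: "[:1, cnj a:] = smult (cnj a) [:- antipode a, 1:]"
        using 3 by (simp add: antipode_def)
      have "1 / cnj a * cnj a = 1" using 3 by simp
      then have nq: "n = q * smult (1 / cnj a) n2"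
        unfolding q_def n1 n2 eq
        by (simp only: mult_smult_left mult_smult_right smult_smult mult.assoc smult_1_left)
      have "degree q = degree [:- a, 1:] + degree [:1, cnj a:]"
        unfolding q_def using 3 by (intro degree_mult_eq) auto
      then have "degree q > 0" by simp
      from antipodal_form_mult_factor[OF cancel[OF nq _ this] 3(1)] antipodal_factor_poly[of a]
      have "antipodal_form k (antipodal_factor a * (to_fract (smult (1 / cnj a) n2) / to_fract d))"
        by (simp add: q_def)
      also have "antipodal_factor a * (to_fract (smult (1 / cnj a) n2) / to_fract d) = to_fract n / to_fract d"
        unfolding nq to_fract_mult q_def antipodal_factor_def by simp
      finally show ?thesis .
    qed
  qed
  consider "degree n > 0" | "degree d > 0" | "degree n = 0" "degree d = 0" by blast
  then show ?case
  proof cases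
    case 1
    then show ?thesis by (rule step[OF less.prems _ less.hyps])
  next
    case 2
    have "antipodal_form (- k) (to_fract d / to_fract n)"
    proof (rule step[OF antipodal_swap[OF less.prems(1)] less.prems(3,2) 2])
      show "antipodal_form k' (to_fract n' / to_fract d')"
        if "degree n' + degree d' < degree d + degree n" "antipodal k' n' d'" "n' \<noteq> 0" "d' \<noteq> 0"
        for k' n' d'
        using that by (intro less.hyps) (simp_all add: add.commute)
    qed
    from antipodal_form_inverse[OF this] show ?thesis by simp
  next
    case 3
    then obtain a b where ab: "n = [:a:]" "d = [:b:]" by (meson degree_eq_zeroE)
    with less.prems have nz: "a \<noteq> 0" "b \<noteq> 0" by auto
    have "antipodal k [:a:] [:b:]" using less.prems ab by simp
    from antipodal_constants[OF this nz] obtain C where k: "k = 0" and C: "a / b = complex_of_real C"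
      by (auto elim: Reals_cases)
    have "to_fract n = to_fract [:complex_of_real C:] * to_fract d"
      unfolding to_fract_mult[symmetric] using nz C by (simp add: ab field_simps)
    then have "to_fract n / to_fract d = to_fract [:complex_of_real C:]"
      using less.prems by simp
    then show ?thesis unfolding antipodal_form_def k
      by (intro exI[of _ C] exI[of _ 0] exI[of _ "[]"]) simp
  qed
qed

lemma antipodal_form_0_imp_p2gg_rational:
  assumes "antipodal_form 0 Q" shows "Q \<in> p2gg_rational"
proof -
  obtain C p as bs where *: "0 \<notin> set as \<union> set bs"
     "Q = to_fract [:complex_of_real C:] * to_fract [:0, 1:] powi p *
       (prod_list (map antipodal_factor as) / prod_list (map antipodal_factor bs))"
     "0 = p + int (length as) - int (length bs)"
    using assms by (rule antipodal_formE)
  \<comment> \<open>All exponents are taken to be 1; a multiple root becomes several equal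
    \<open>a k\<close>.\<close>
  have prod: "prod_list (map antipodal_factor xs) = (\<Prod>k<length xs. antipodal_factor (xs ! k) ^ 1)" for xs
    by (simp add: prod.list_conv_set_nth atLeast0LessThan)
  show ?thesis unfolding p2gg_rational_def mem_Collect_eq
    by (rule exI[of _ C], rule exI[of _ p], rule exI[of _ "length as"], rule exI[of _ "length bs"],
        rule exI[of _ "(!) as"], rule exI[of _ "(!) bs"], rule exI[of _ "\<lambda>_. 1"], rule exI[of _ "\<lambda>_. 1"])
       (use * in \<open>auto simp: prod in_set_conv_nth\<close>)
qed

lemma antipodal_imp_p2gg_rational:
  assumes "antipodal 0 n d" "d \<noteq> 0"
  shows "to_fract n / to_fract d \<in> p2gg_rational"
proof (cases "n = 0")
  case True
  \<comment> \<open>The zero function belongs to the family through \<open>C = 0\<close>; the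
    induction on degrees concerns nonzero \<open>n\<close> only.\<close>
  have "antipodal_form 0 0" unfolding antipodal_form_def
    by (intro exI[of _ "0::real"] exI[of _ 0] exI[of _ "[]"]) simp
  with True show ?thesis by (simp add: antipodal_form_0_imp_p2gg_rational)
qed (use assms in \<open>intro antipodal_form_0_imp_p2gg_rational antipodal_imp_form\<close>)

definition antipodal_fract :: "int \<Rightarrow> complex poly fract \<Rightarrow> bool" where
  "antipodal_fract k Q \<longleftrightarrow> (\<exists>n d. d \<noteq> 0 \<and> Q = to_fract n / to_fract d \<and> antipodal k n d)"

lemma antipodal_fract_mult:
  assumes "antipodal_fract k Q" "antipodal_fract k' Q'"
  shows "antipodal_fract (k + k') (Q * Q')"
proof -
  obtain n d n' d' where "d \<noteq> 0" "Q = to_fract n / to_fract d" "antipodal k n d"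
    "d' \<noteq> 0" "Q' = to_fract n' / to_fract d'" "antipodal k' n' d'"
    using assms unfolding antipodal_fract_def by blast
  then show ?thesis unfolding antipodal_fract_def
    by (intro exI[of _ "n * n'"] exI[of _ "d * d'"]) (simp add: antipodal_mult)
qed

lemma antipodal_fract_inverse:
  assumes "antipodal_fract k Q" "Q \<noteq> 0"
  shows "antipodal_fract (- k) (inverse Q)"
proof -
  obtain n d where "d \<noteq> 0" "Q = to_fract n / to_fract d" "antipodal k n d"
    using assms unfolding antipodal_fract_def by blast
  then show ?thesis unfolding antipodal_fract_def
    using assms(2) by (intro exI[of _ d] exI[of _ n]) (auto intro: antipodal_swap)
qed

lemma antipodal_fract_of_poly: "antipodal k q 1 \<Longrightarrow> antipodal_fract k (to_fract q)"
  unfolding antipodal_fract_def by (rule exI[of _ q], rule exI[of _ 1]) simp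

lemma antipodal_fract_power:
  "antipodal_fract k Q \<Longrightarrow> antipodal_fract (k * int m) (Q ^ m)"
proof (induction m)
  case 0
  then show ?case using antipodal_fract_of_poly[OF antipodal_same[of 1]] by simp
next
  case (Suc m)
  then show ?case using antipodal_fract_mult[of k Q "k * int m" "Q ^ m"] by (simp add: algebra_simps)
qed

lemma antipodal_fract_powi:
  assumes "antipodal_fract k Q" "Q \<noteq> 0" shows "antipodal_fract (k * p) (Q powi p)"
proof (cases "p \<ge> 0")
  case True
  then show ?thesis using antipodal_fract_power[OF assms(1), of "nat p"] by (simp add: power_int_def)
next
  case False
  then show ?thesis
    using antipodal_fract_power[OF antipodal_fract_inverse[OF assms], of "nat (- p)"]
    by (simp add: power_int_def)
qed

lemma antipodal_fract_prod:
  fixes m :: "nat \<Rightarrow> nat"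
  shows "antipodal_fract (\<Sum>k<r. int (m k)) (\<Prod>k<r. antipodal_factor (a k) ^ m k)"
proof (induction r)
  case 0
  then show ?case using antipodal_fract_of_poly[OF antipodal_same[of 1]] by simp
next
  case (Suc r)
  have "antipodal_fract (1 * int (m r)) (antipodal_factor (a r) ^ m r)"
    unfolding antipodal_factor_def by (intro antipodal_fract_power antipodal_fract_of_poly antipodal_factor_poly)
  from antipodal_fract_mult[OF Suc this] show ?case by simp
qed

text \<open>The condition on the exponents says exactly that the weights of all factors add up to
  0.\<close>

lemma p2gg_rational_imp_antipodal:
  assumes "Q \<in> p2gg_rational"
  obtains n d where "d \<noteq> 0" "Q = to_fract n / to_fract d" "antipodal 0 n d"
proof -
  obtain C p a b \<kappa> \<mu> and r s :: nat where Q: "Q = to_fract [:complex_of_real C:] * to_fract [:0, 1:] powi p *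
        ((\<Prod>k<r. antipodal_factor (a k) ^ \<kappa> k) / (\<Prod>l<s. antipodal_factor (b l) ^ \<mu> l))"
    and sum: "(\<Sum>l<s. int (\<mu> l)) = p + (\<Sum>k<r. int (\<kappa> k))"
    using assms unfolding p2gg_rational_def by blast
  have "(\<Prod>l<s. antipodal_factor (b l) ^ \<mu> l) \<noteq> 0"
    by (auto simp: antipodal_factor_def)
  then have "antipodal_fract (0 + 1 * p + ((\<Sum>k<r. int (\<kappa> k)) + - (\<Sum>l<s. int (\<mu> l)))) Q"
    unfolding Q divide_inverse
    by (intro antipodal_fract_mult antipodal_fract_inverse antipodal_fract_prod antipodal_fract_powi
        antipodal_fract_of_poly antipodal_X antipodal_const to_fract_X_nonzero)
  with sum show thesis using that unfolding antipodal_fract_def by auto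
qed

text \<open>Since \<open>cnj (antipode w) = - 1 / w\<close>, the conjugated composite is a
  polynomial in \<open>1 / w\<close>. A power of \<open>w\<close> clears the denominators, and
  antipodal identities become equalities of polynomials.\<close>

lemma antipodal_polynomial:
  obtains m p where "\<And>w. w \<noteq> 0 \<Longrightarrow> w ^ m * cnj (poly n (antipode w)) = poly p w"
proof (induction n arbitrary: thesis)
  case 0
  show ?case by (rule 0[of 0 0]) simp
next
  case (pCons a n)
  obtain m p where mp: "\<And>w. w \<noteq> 0 \<Longrightarrow> w ^ m * cnj (poly n (antipode w)) = poly p w"
    using pCons.IH by blast
  show ?case
  proof (rule pCons.prems)
    fix w :: complex assume "w \<noteq> 0"
    then have "w ^ Suc m * cnj (poly (pCons a n) (antipode w)) =
        cnj a * w ^ Suc m - w ^ m * cnj (poly n (antipode w))"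
      by (simp add: antipode_def field_simps)
    with mp[OF \<open>w \<noteq> 0\<close>] show "w ^ Suc m * cnj (poly (pCons a n) (antipode w)) = poly (monom (cnj a) (Suc m) - p) w"
      by (simp add: poly_monom)
  qed
qed

text \<open>Links an arbitrary representation to the coprime pair through which
  \<open>rational_map\<close> is defined.\<close>

lemma quot_of_fract_cross:
  assumes "quot_of_fract (to_fract n / to_fract d) = (n', d')" "d \<noteq> 0"
  shows "n * d' = n' * (d :: complex poly)"
proof -
  have d': "d' \<noteq> 0" using snd_quot_of_fract_nonzero[of "to_fract n / to_fract d"] by (simp add: assms)
  have "Fract n' d' = Fract n d"
    using Fract_quot_of_fract[of "to_fract n / to_fract d"] assms
    by (simp add: Fract_conv_to_fract)
  with d' assms(2) show ?thesis by (simp add: eq_fract mult_ac)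
qed

section \<open>Invariance under the group\<close>

definition antiaffine :: "(complex \<Rightarrow> complex) \<Rightarrow> bool" where
  "antiaffine g \<longleftrightarrow> (\<exists>a b. a \<noteq> 0 \<and> g = (\<lambda>z. a * cnj z + b))"

text \<open>Unlike invariance under \<open>modified_action\<close>, this records that a map in the
  second case is antiaffine, which makes the property stable under composition and inversion. With
  the conjugation on the side of \<open>f z\<close>, two conjugations cancel in a
  composition.\<close>

definition fixed_by :: "(complex \<Rightarrow> riemann_sphere) \<Rightarrow> (complex \<Rightarrow> complex) \<Rightarrow> bool" where
  "fixed_by f g \<longleftrightarrow>
     sense_preserving g \<and> (\<forall>z. f (g z) = f z) \<or>
     antiaffine g \<and> (\<forall>z. f (g z) = map_option cnj (f z))"

lemma map_option_cnj_cnj [simp]: "map_option cnj (map_option cnj x) = x"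
  by (cases x) auto

lemma sense_preserving_affine: "a \<noteq> 0 \<Longrightarrow> sense_preserving (\<lambda>z. a * z + b)"
  unfolding sense_preserving_def by blast

lemma antiaffine_anti: "a \<noteq> 0 \<Longrightarrow> antiaffine (\<lambda>z. a * cnj z + b)"
  unfolding antiaffine_def by blast

lemma sense_preservingE:
  assumes "sense_preserving g"
  obtains a b where "a \<noteq> 0" "g = (\<lambda>z. a * z + b)"
  using assms unfolding sense_preserving_def by (elim exE conjE) (rule that)

lemma antiaffineE:
  assumes "antiaffine g"
  obtains a b where "a \<noteq> 0" "g = (\<lambda>z. a * cnj z + b)"
  using assms unfolding antiaffine_def by (elim exE conjE) (rule that)

lemma antiaffine_not_sense_preserving: "antiaffine g \<Longrightarrow> \<not> sense_preserving g"
proof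
  assume "antiaffine g" "sense_preserving g"
  then obtain a b a' b' where "a \<noteq> 0" and eq: "\<And>z. a * cnj z + b = a' * z + b'"
    unfolding antiaffine_def sense_preserving_def by metis
  \<comment> \<open>The three values give \<open>b = b'\<close>, \<open>a = a'\<close> and
    \<open>- a = a'\<close>.\<close>
  with eq[of 0] eq[of 1] eq[of \<i>] show False by simp
qed

lemma fixed_by_modified_action: "fixed_by f g \<Longrightarrow> modified_action g f = f"
  unfolding fixed_by_def modified_action_def
  using antiaffine_not_sense_preserving by (auto simp: fun_eq_iff)

lemma fixed_by_compose: "fixed_by f g \<Longrightarrow> fixed_by f h \<Longrightarrow> fixed_by f (g \<circ> h)"
proof -
  have sp: "sense_preserving (g \<circ> h)" if gh: "sense_preserving g" "sense_preserving h"
  proof -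
    obtain a b where g: "a \<noteq> 0" "g = (\<lambda>z. a * z + b)"
      using gh(1) by (rule sense_preservingE)
    obtain a' b' where h: "a' \<noteq> 0" "h = (\<lambda>z. a' * z + b')"
      using gh(2) by (rule sense_preservingE)
    show ?thesis
      using g h sense_preserving_affine[of "a * a'" "a * b' + b"] by (simp add: o_def algebra_simps)
  qed
  have spa: "antiaffine (g \<circ> h)" if gh: "sense_preserving g" "antiaffine h"
  proof -
    obtain a b where g: "a \<noteq> 0" "g = (\<lambda>z. a * z + b)"
      using gh(1) by (rule sense_preservingE)
    obtain a' b' where h: "a' \<noteq> 0" "h = (\<lambda>z. a' * cnj z + b')"
      using gh(2) by (rule antiaffineE)
    show ?thesis
      using g h antiaffine_anti[of "a * a'" "a * b' + b"] by (simp add: o_def algebra_simps)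
  qed
  have asp: "antiaffine (g \<circ> h)" if gh: "antiaffine g" "sense_preserving h"
  proof -
    obtain a b where g: "a \<noteq> 0" "g = (\<lambda>z. a * cnj z + b)"
      using gh(1) by (rule antiaffineE)
    obtain a' b' where h: "a' \<noteq> 0" "h = (\<lambda>z. a' * z + b')"
      using gh(2) by (rule sense_preservingE)
    show ?thesis
      using g h antiaffine_anti[of "a * cnj a'" "a * cnj b' + b"] by (simp add: o_def algebra_simps)
  qed
  have aa: "sense_preserving (g \<circ> h)" if gh: "antiaffine g" "antiaffine h"
  proof -
    obtain a b where g: "a \<noteq> 0" "g = (\<lambda>z. a * cnj z + b)"
      using gh(1) by (rule antiaffineE)
    obtain a' b' where h: "a' \<noteq> 0" "h = (\<lambda>z. a' * cnj z + b')"
      using gh(2) by (rule antiaffineE)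
    show ?thesis
      using g h sense_preserving_affine[of "a * cnj a'" "a * cnj b' + b"] by (simp add: o_def algebra_simps)
  qed
  assume "fixed_by f g" "fixed_by f h"
  then show ?thesis unfolding fixed_by_def using sp spa asp aa by auto
qed

lemma fixed_by_bij: "fixed_by f g \<Longrightarrow> bij g"
proof -
  assume "fixed_by f g"
  then consider a b where "a \<noteq> 0" "g = (\<lambda>z. a * z + b)" | a b where "a \<noteq> 0" "g = (\<lambda>z. a * cnj z + b)"
    unfolding fixed_by_def using sense_preservingE antiaffineE by metis
  then show "bij g"
  proof cases
    case 1
    then show ?thesis by (intro o_bij[of "\<lambda>z. (z - b) / a"]) (auto simp: fun_eq_iff)
  next
    case 2
    then show ?thesis by (intro o_bij[of "\<lambda>z. cnj ((z - b) / a)"]) (auto simp: fun_eq_iff)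
  qed
qed

lemma fixed_by_inv: "fixed_by f g \<Longrightarrow> fixed_by f (inv_into UNIV g)"
proof -
  assume fixed: "fixed_by f g"
  have gi: "g (inv_into UNIV g z) = z" for z using fixed_by_bij[OF fixed] by (simp add: bij_is_surj surj_f_inv_f)
  have ig: "inv_into UNIV g (g z) = z" for z using fixed_by_bij[OF fixed] by (simp add: bij_is_inj)
  from fixed consider a b where "a \<noteq> 0" "g = (\<lambda>z. a * z + b)" "\<And>z. f (g z) = f z"
    | a b where "a \<noteq> 0" "g = (\<lambda>z. a * cnj z + b)" "\<And>z. f (g z) = map_option cnj (f z)"
    unfolding fixed_by_def using sense_preservingE antiaffineE by metis
  then show "fixed_by f (inv_into UNIV g)"
  proof cases
    case 1
    have "inv_into UNIV g z = (1 / a) * z + (- b / a)" for z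
    proof -
      have "g ((1 / a) * z + (- b / a)) = z" using 1(1,2) by (simp add: field_simps)
      then show ?thesis using ig by metis
    qed
    then have "inv_into UNIV g = (\<lambda>z. (1 / a) * z + (- b / a))" by (rule ext)
    then have "sense_preserving (inv_into UNIV g)" using 1(1) sense_preserving_affine[of "1 / a" "- b / a"] by simp
    moreover have "f (inv_into UNIV g z) = f z" for z using 1(3)[of "inv_into UNIV g z"] by (simp add: gi)
    ultimately show ?thesis unfolding fixed_by_def by blast
  next
    case 2
    have "inv_into UNIV g z = cnj (1 / a) * cnj z + cnj (- b / a)" for z
    proof -
      have "g (cnj (1 / a) * cnj z + cnj (- b / a)) = z" using 2(1,2) by (simp add: field_simps)
      then show ?thesis using ig by metis
    qed
    then have "inv_into UNIV g = (\<lambda>z. cnj (1 / a) * cnj z + cnj (- b / a))" by (rule ext)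
    then have "antiaffine (inv_into UNIV g)" using 2(1) antiaffine_anti[of "cnj (1 / a)" "cnj (- b / a)"] by simp
    moreover have "f (inv_into UNIV g z) = map_option cnj (f z)" for z
      using 2(3)[of "inv_into UNIV g z"] by (simp add: gi)
    ultimately show ?thesis unfolding fixed_by_def by blast
  qed
qed

lemma invariant_under_generate:
  assumes "\<And>g. g \<in> H \<Longrightarrow> fixed_by f g"
  shows "invariant_under (generate (BijGroup UNIV) H) f"
proof -
  have Bij: "g \<in> Bij UNIV" if "fixed_by f g" for g
    using fixed_by_bij[OF that] by (simp add: Bij_def)
  have "fixed_by f g" if "g \<in> generate (BijGroup UNIV) H" for g
    using that
  proof (induction rule: generate.induct)
    case one
    have "fixed_by f (\<lambda>x. x)"
      using sense_preserving_affine[of 1 0] by (simp add: fixed_by_def)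
    then show ?case by (simp add: BijGroup_def)
  next
    case (inv h)
    then have h: "fixed_by f h" by (rule assms)
    have "inv\<^bsub>BijGroup UNIV\<^esub> h = inv_into UNIV h"
      using inv_BijGroup[OF Bij[OF h]] by (simp add: restrict_def)
    then show ?case using fixed_by_inv[OF h] by simp
  next
    case (eng g h)
    then have "g \<otimes>\<^bsub>BijGroup UNIV\<^esub> h = g \<circ> h"
      using Bij by (simp add: BijGroup_def compose_def o_def fun_eq_iff)
    then show ?case using fixed_by_compose[OF eng.IH] by (simp only:)
  qed (rule assms)
  then show ?thesis
    unfolding invariant_under_def using fixed_by_modified_action by blast
qed

section \<open>The action of the group on the values of \<open>W\<close>\<close>

context rectangular_lattice
begin

definition glide :: "complex \<Rightarrow> complex" where "glide z = cnj (z + \<omega>)"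

lemma glide_affine: "glide = (\<lambda>z. 1 * cnj z + cnj \<omega>)"
  by (simp add: glide_def fun_eq_iff)

text \<open>From right to left, \<open>fixed_by\<close> is inherited by the generated group. From
  left to right the generators lie in the group, and the glide reflexion falls under the conjugating
  branch of the action because it is antiaffine.\<close>

lemma invariant_iff:
  "invariant_under (p2gg_group \<alpha> \<beta>) f \<longleftrightarrow>
     (\<forall>u\<in>\<Lambda>. \<forall>z. f (z + u) = f z) \<and> (\<forall>z. f (- z) = f z) \<and> (\<forall>z. f (glide z) = map_option cnj (f z))"
  (is "?lhs \<longleftrightarrow> ?rhs")
proof
  assume ?rhs
  have "fixed_by f (\<lambda>z. z + u)" if "u \<in> \<Lambda>" for u
    using \<open>?rhs\<close> that sense_preserving_affine[of 1 u] by (simp add: fixed_by_def)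
  moreover have "fixed_by f (\<lambda>z. - z)"
    using \<open>?rhs\<close> sense_preserving_affine[of "- 1" 0] by (simp add: fixed_by_def)
  moreover have "fixed_by f (\<lambda>z. cnj (z + \<omega>))"
    using \<open>?rhs\<close> antiaffine_anti[of 1 "cnj \<omega>"]
    unfolding fixed_by_def glide_affine[symmetric] by (simp add: glide_def[abs_def])
  ultimately show ?lhs
    unfolding p2gg_group_def lattice[symmetric] by (intro invariant_under_generate) auto
next
  assume inv: ?lhs
  have act: "modified_action g f = f"
    if "g \<in> {(\<lambda>z. z + u) | u. u \<in> \<Lambda>} \<union> {\<lambda>z. - z} \<union> {\<lambda>z. cnj (z + \<omega>)}" for g
    using inv that unfolding invariant_under_def p2gg_group_def lattice[symmetric]
    by (blast intro: generate.incl)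
  have "f (z + u) = f z" if "u \<in> \<Lambda>" for u z
  proof -
    have "modified_action (\<lambda>z. z + u) f = f" using that by (intro act) blast
    then show ?thesis
      using sense_preserving_affine[of 1 u] by (simp add: modified_action_def fun_eq_iff)
  qed
  moreover have "f (- z) = f z" for z
  proof -
    have "modified_action (\<lambda>z. - z) f = f" by (intro act) blast
    then show ?thesis
      using sense_preserving_affine[of "- 1" 0] by (simp add: modified_action_def fun_eq_iff)
  qed
  moreover have "f (glide z) = map_option cnj (f z)" for z
  proof -
    have "modified_action glide f = f"
      unfolding glide_def[abs_def] by (intro act) blast
    moreover have "\<not> sense_preserving glide"
      unfolding glide_affine by (intro antiaffine_not_sense_preserving antiaffine_anti) simp
    ultimately have "map_option cnj (f (glide z)) = f z"
      unfolding modified_action_def by (simp add: fun_eq_iff)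
    then show ?thesis by (metis map_option_cnj_cnj)
  qed
  ultimately show ?rhs by blast
qed

lemma filterlim_glide: "filterlim glide (at (glide z)) (at z)"
  unfolding glide_def
  by (intro filterlim_atI tendsto_intros) (auto simp: eventually_at_filter)

text \<open>\<open>W\<close> is analytic at all points of a punctured neighbourhood of
  \<open>z\<close>, and it cannot be analytic at a lattice point, where it tends to
  infinity.\<close>

lemma eventually_off_lattice: "\<forall>\<^sub>F x in at z. x \<notin> \<Lambda>"
proof -
  have "\<forall>\<^sub>F x in at z. W analytic_on {x}"
    using meromorphic_on_imp_analytic_cosparse[OF W_meromorphic]
    by (simp add: eventually_cosparse_open_eq)
  then show ?thesis
  proof eventually_elim
    case (elim x)
    show ?case
    proof
      assume "x \<in> \<Lambda>"
      moreover have "(W \<longlongrightarrow> W x) (at x)"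
        using analytic_at_imp_isCont[OF elim] by (simp add: isCont_def)
      ultimately show False
        using not_tendsto_and_filterlim_at_infinity[OF _ _ W_at_lattice] by auto
    qed
  qed
qed

lemma eventually_W_glide: "\<forall>\<^sub>F x in at z. W (glide x) = antipode (W x)"
proof -
  have "\<forall>\<^sub>F x in at z. cnj (glide x) \<notin> \<Lambda>"
    using eventually_compose_filterlim[OF eventually_off_lattice filterlim_glide] by simp
  with eventually_off_lattice show ?thesis
  proof eventually_elim
    case (elim x)
    then have "W x * W (x + \<omega>) = - 1" by (intro W_translate) (simp_all add: glide_def)
    moreover from this have "W x \<noteq> 0" by auto
    ultimately have "W (x + \<omega>) = - 1 / W x" by (simp only: eq_divide_eq mult.commute if_True not_False_eq_True)
    then show ?case unfolding glide_def W_cnj antipode_def by simp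
  qed
qed

lemma eventually_W_cofinite:
  assumes "\<forall>\<^sub>F w in cofinite. P w" shows "\<forall>\<^sub>F x in at z. P (W x)"
proof -
  have fin: "finite {w. \<not> P w}" using assms by (simp add: eventually_cofinite)
  \<comment> \<open>The finitely many excluded values are the roots of one nonzero
    polynomial.\<close>
  then have "(\<Prod>w\<in>{w. \<not> P w}. [:- w, 1:]) \<noteq> 0" by simp
  from eventually_poly_W_nonzero[OF this] show ?thesis
    by eventually_elim (use fin in \<open>auto simp: poly_prod\<close>)
qed

lemma W_sphere_periodic: "u \<in> \<Lambda> \<Longrightarrow> W_sphere (z + u) = W_sphere z"
  by (simp add: W_sphere_def weierstrass_sphere_def lattice_add_iff wp_periodic)

lemma W_sphere_minus: "W_sphere (- z) = W_sphere z"
  by (simp add: W_sphere_def weierstrass_sphere_def wp_minus)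

lemma rational_W_eq:
  assumes "quot_of_fract (to_fract n / to_fract d) = (n', d')" "d \<noteq> 0"
  shows "\<forall>\<^sub>F x in at z. poly n' (W x) / poly d' (W x) = poly n (W x) / poly d (W x)"
proof -
  have cross: "n * d' = n' * d" using quot_of_fract_cross[OF assms] .
  have "d' \<noteq> 0" using snd_quot_of_fract_nonzero[of "to_fract n / to_fract d"] by (simp add: assms)
  from eventually_poly_W_nonzero[OF this] eventually_poly_W_nonzero[OF assms(2)]
  show ?thesis
  proof eventually_elim
    case (elim x)
    have "poly n (W x) * poly d' (W x) = poly n' (W x) * poly d (W x)"
      using arg_cong[OF cross, of "\<lambda>p. poly p (W x)"] by simp
    with elim show ?case by (simp add: frac_eq_eq)
  qed
qed

lemma rational_W_invariant:
  assumes Q: "Q \<in> p2gg_rational"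
  shows "meromorphic_to_sphere (\<lambda>z. rational_map Q (W_sphere z))"
    "invariant_under (p2gg_group \<alpha> \<beta>) (\<lambda>z. rational_map Q (W_sphere z))"
proof -
  obtain n d where nd: "d \<noteq> 0" "Q = to_fract n / to_fract d" and anti: "antipodal 0 n d"
    using p2gg_rational_imp_antipodal[OF Q] .
  obtain n' d' where nd': "quot_of_fract Q = (n', d')" by (cases "quot_of_fract Q")
  define R where "R = (\<lambda>x. poly n' (W x) / poly d' (W x))"
  have R: "tends_sphere R (at z) (rational_map Q (W_sphere z))" for z
    unfolding R_def by (rule tends_sphere_rational_W[OF nd'])
  have "R meromorphic_on UNIV"
    unfolding R_def by (intro meromorphic_intros meromorphic_on_poly W_meromorphic)
  then show "meromorphic_to_sphere (\<lambda>z. rational_map Q (W_sphere z))"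
    using R by (rule meromorphic_to_sphereI)
  have ev: "\<forall>\<^sub>F x in at z. R x = poly n (W x) / poly d (W x)" for z
    unfolding R_def using nd nd' by (intro rational_W_eq) auto
  \<comment> \<open>Both sides are limits, at the same point, of functions that agree nearby; this
    includes infinite values and the lattice points.\<close>
  have glide: "rational_map Q (W_sphere (glide z)) = map_option cnj (rational_map Q (W_sphere z))" for z
  proof (rule tends_sphere_unique)
    show "tends_sphere (\<lambda>x. R (glide x)) (at z) (rational_map Q (W_sphere (glide z)))"
      by (rule tends_sphere_compose[OF R filterlim_glide])
    show "tends_sphere (\<lambda>x. cnj (R x)) (at z) (map_option cnj (rational_map Q (W_sphere z)))"
      by (rule tends_sphere_cnj[OF R])
    show "\<forall>\<^sub>F x in at z. R (glide x) = cnj (R x)"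
      using eventually_W_glide ev[of z] eventually_compose_filterlim[OF ev filterlim_glide]
        eventually_W_cofinite[OF anti[unfolded antipodal_def]]
        eventually_poly_W_nonzero[OF nd(1), of z]
        eventually_W_cofinite[OF eventually_cofinite_antipode[OF eventually_cofinite_poly[OF nd(1)]]]
    proof eventually_elim
      case (elim x)
      have "poly n (W x) / poly d (W x) = cnj (poly n (antipode (W x)) / poly d (antipode (W x)))"
        using elim(4-6) by (simp add: frac_eq_eq)
      then show ?case using elim(1-3) by simp
    qed
  qed simp
  then show "invariant_under (p2gg_group \<alpha> \<beta>) (\<lambda>z. rational_map Q (W_sphere z))"
    unfolding invariant_iff by (simp add: W_sphere_periodic W_sphere_minus)
qed

text \<open>Clearing powers of \<open>w\<close> turns the identity into
  \<open>poly P (W x) = 0\<close> for \<open>x\<close> near 0. Hence \<open>P = 0\<close>, and the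
  identity holds for every nonzero \<open>w\<close>.\<close>

lemma antipodalI_W:
  assumes ev: "\<forall>\<^sub>F x in at 0. poly n (W x) * cnj (poly d (antipode (W x))) =
      cnj (poly n (antipode (W x))) * poly d (W x)"
  shows "antipodal 0 n d"
proof -
  obtain m p where p: "\<And>w. w \<noteq> 0 \<Longrightarrow> w ^ m * cnj (poly n (antipode w)) = poly p w"
    using antipodal_polynomial[of n] by metis
  obtain l q where q: "\<And>w. w \<noteq> 0 \<Longrightarrow> w ^ l * cnj (poly d (antipode w)) = poly q w"
    using antipodal_polynomial[of d] by metis
  define P where "P = n * q * monom 1 m - p * d * monom 1 l"
  have P: "poly P w = w ^ m * w ^ l * (poly n w * cnj (poly d (antipode w)) - cnj (poly n (antipode w)) * poly d w)"
    if "w \<noteq> 0" for w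
    using p[OF that, symmetric] q[OF that, symmetric] by (simp add: P_def poly_monom algebra_simps)
  have P0: "P = 0"
  proof (rule ccontr)
    assume "P \<noteq> 0"
    from eventually_poly_W_nonzero[OF this, of 0] ev eventually_W_cofinite[OF eventually_cofinite_neq[of 0], of 0]
    have "\<forall>\<^sub>F x in at (0::complex). False" by eventually_elim (simp add: P)
    then show False by (simp add: trivial_limit_def[symmetric])
  qed
  show ?thesis
    unfolding antipodal_def using eventually_cofinite_neq[of 0]
    by eventually_elim (use P P0 in simp)
qed

lemma invariant_imp_rational:
  assumes mero: "meromorphic_to_sphere f" and inv: "invariant_under (p2gg_group \<alpha> \<beta>) f"
  obtains Q where "Q \<in> p2gg_rational" "f = (\<lambda>z. rational_map Q (W_sphere z))"
proof -
  obtain g where g: "g meromorphic_on UNIV" "\<And>z. tends_sphere g (at z) (f z)"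
    "\<And>z. g z = (case f z of None \<Rightarrow> 0 | Some l \<Rightarrow> l)"
    using meromorphic_to_sphereE[OF mero] by metis
  have per: "g (z + u) = g z" if "u \<in> \<Lambda>" for u z
    using inv that unfolding invariant_iff g(3) by simp
  have even: "g (- z) = g z" for z using inv unfolding invariant_iff g(3) by simp
  have glide: "g (glide z) = cnj (g z)" for z
    using inv unfolding invariant_iff g(3) by (auto split: option.splits)
  obtain n d where d0: "d \<noteq> 0" and nd: "\<And>z. \<forall>\<^sub>F x in at z. g x = poly n (W x) / poly d (W x)"
    using even_elliptic_rational[OF g(1) per even] by metis
  have "\<forall>\<^sub>F x in at 0. poly n (W x) * cnj (poly d (antipode (W x))) =
      cnj (poly n (antipode (W x))) * poly d (W x)"
    using eventually_W_glide[of 0] nd[of 0] eventually_compose_filterlim[OF nd filterlim_glide, of 0]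
      eventually_poly_W_nonzero[OF d0, of 0]
      eventually_compose_filterlim[OF eventually_poly_W_nonzero[OF d0] filterlim_glide, of 0]
  proof eventually_elim
    case (elim x)
    have "poly n (W x) / poly d (W x) = cnj (poly n (antipode (W x)) / poly d (antipode (W x)))"
      using elim(1-3) glide[of x] by (metis complex_cnj_cnj)
    then show ?case using elim(1,4,5) by (simp add: frac_eq_eq)
  qed
  then have "antipodal 0 n d" by (rule antipodalI_W)
  define Q where "Q = to_fract n / to_fract d"
  have Q: "Q \<in> p2gg_rational"
    unfolding Q_def using \<open>antipodal 0 n d\<close> d0 by (rule antipodal_imp_p2gg_rational)
  obtain n' d' where nd': "quot_of_fract Q = (n', d')" by (cases "quot_of_fract Q")
  show thesis
  proof (rule that[OF Q], rule ext)
    fix z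
    show "f z = rational_map Q (W_sphere z)"
    \<comment> \<open>The equality is known on punctured neighbourhoods only; as both sides are
      limits it extends to every point, poles included.\<close>
    proof (rule tends_sphere_unique[OF g(2) tends_sphere_rational_W[OF nd']])
      show "\<forall>\<^sub>F x in at z. g x = poly n' (W x) / poly d' (W x)"
        using nd[of z] rational_W_eq[OF nd'[unfolded Q_def] d0, of z]
        by eventually_elim simp
    qed simp
  qed
qed

end

theorem mainTheorem10:
  fixes \<alpha> \<beta> :: real and \<Lambda> :: "complex set" and e\<^sub>1 e\<^sub>2 e\<^sub>3 a c :: complex
  assumes "\<alpha> > 0" and "\<beta> > 0"
    and "\<Lambda> = rect_lattice \<alpha> \<beta>"
    and "e\<^sub>1 = weierstrass_p \<Lambda> (complex_of_real \<alpha> / 2)"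
    and "e\<^sub>2 = weierstrass_p \<Lambda> (complex_of_real \<beta> * \<i> / 2)"
    and "e\<^sub>3 = weierstrass_p \<Lambda> ((complex_of_real \<alpha> + complex_of_real \<beta> * \<i>) / 2)"
    and "a = e\<^sub>3"
    and "c = csqrt ((e\<^sub>1 - e\<^sub>3) * (e\<^sub>3 - e\<^sub>2))"
  shows "(e\<^sub>1 \<in> \<real> \<and> e\<^sub>2 \<in> \<real> \<and> e\<^sub>3 \<in> \<real> \<and> Re e\<^sub>1 > Re e\<^sub>3 \<and> Re e\<^sub>3 > Re e\<^sub>2) \<and>
    {f. meromorphic_to_sphere f \<and> invariant_under (p2gg_group \<alpha> \<beta>) f} =
    {\<lambda>z. rational_map Q (map_option (\<lambda>w. (w - a) / c) (weierstrass_sphere \<Lambda> z))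
      | Q. Q \<in> p2gg_rational}"
proof -
  interpret rectangular_lattice \<alpha> \<beta> \<Lambda>
    using assms(1-3) by unfold_locales
  have scale: "c = \<sigma>" unfolding scale_def assms(4-6,8) ..
  have sphere: "map_option (\<lambda>w. (w - a) / c) (weierstrass_sphere \<Lambda> z) = W_sphere z" for z
    unfolding W_sphere_def scale assms(6,7) ..
  have "{f. meromorphic_to_sphere f \<and> invariant_under (p2gg_group \<alpha> \<beta>) f} =
      {\<lambda>z. rational_map Q (W_sphere z) | Q. Q \<in> p2gg_rational}"
    using rational_W_invariant by (auto elim: invariant_imp_rational)
  then show ?thesis
    unfolding sphere assms(4-6) using wp_half_period_real wp_half_period_order by blast
qed

end
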